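(* Let $\mathcal A=\{a_1,\dots,a_n\}\subset\mathbb Z^d$ be a point configuration and let $A$ be the matrix whose columns are the points of $\mathcal A$ with an additional row of ones. Let $I$ be a monomial $A$-graded ideal and $x^a-x^b$ a flippable binomial for $I$. Then either $\Delta(rad(I))=\Delta(rad(I_{flip}))$, or the triangulations $\Delta(rad(I))$ and $\Delta(rad(I_{flip}))$ of $\mathcal A$ differ by a bistellar flip.
   Context: Let $k$ be a field; $\mathbb N$ contains $0$. $A$ is assumed to have full row rank, and the $i$th column of $A$ is again denoted $a_i$. $S=k[x_1,\dots,x_n]$ is graded by letting $\deg x_i$ be the $i$th column of $A$; homogeneous for this grading is called $A$-homogeneous. An $A$-homogeneous ideal $I\subseteq S$ is $A$-graded if $\dim_k(S/I)_b=1$ for $b\in\mathbb N A:=\{\sum m_ia_i:m_i\in\mathbb N\}$ and $0$ otherwise, and monomial $A$-graded if moreover generated by monomials. Graver basis: for $u,v\in\mathbb N^n$ write $u<v$ if $u_i\le v_i$ for all $i$ and $u\ne v$. A binomial $x^u-x^v$ ($u\ne v$) with $Au=Av$ is a Graver binomial if there are no nonzero $u',v'\in\mathbb N^n$ with $Au'=Av'$, $u'<u$, $v'<v$; $Gr_A$ is the set of all of them (up to sign). Flips of ideals: for a monomial $A$-graded ideal $I$ and a Graver binomial $x^a-x^b$ with $x^a$ a minimal generator of $I$ and $x^b\notin I$, put $I_{flip}=\langle x^c:\exists\, d \text{ with } x^c-x^d\in Gr_A,\ x^c\in I,\ x^d\notin I,\ c\neq a\rangle+\langle x^b\rangle$.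 The binomial $x^a-x^b$ is flippable for $I$ if $x^a$ is a minimal generator of $I$, $x^b\notin I$, and $I_{flip}$ is again a monomial $A$-graded ideal. Triangulations: a triangulation of $\mathcal A$ is a geometric simplicial complex covering $\mathrm{conv}(\mathcal A)$ in which the vertices of each simplex form a subset of $\mathcal A$; a simplex $\sigma$ is identified with $\{i:a_i\text{ is a vertex of }\sigma\}\subseteq\{1,\dots,n\}$. For a squarefree monomial ideal $J$, $\Delta(J)=\{\sigma\subseteq\{1,\dots,n\}:\prod_{i\in\sigma}x_i\notin J\}$ (Stanley–Reisner correspondence). It is known that $\Delta(rad(I))$ is a triangulation of $\mathcal A$ for every monomial $A$-graded ideal $I$. Bistellar flips: a circuit $t$ of $\mathcal A$ is a minimal affine dependence among the points, i.e. a vector $0\ne t\in\ker(A)$ of minimal support (with coprime integer entries). Let $T=\{i:t_i\ne0\}$, $T^+=\{i:t_i>0\}$, $T^-=\{i:t_i<0\}$. The set $\mathrm{conv}(a_i:i\in T)$ has exactly two triangulations: $C^+$, with maximal simplices $T\setminus\{i\}$, $i\in T^+$, and $C^-$, with maximal simplices $T\setminus\{i\}$, $i\in T^-$. The link of a simplex $\sigma$ in a simplicial complex $\Delta$ is $\{\tau:\tau\cap\sigma=\emptyset,\ \tau\cup\sigma\in\Delta\}$. If $C^+$ is a subcomplex of a triangulation $\Delta$ and all maximal simplices of $C^+$ have the same link $L$ in $\Delta$, then the bistellar flip of $\Delta$ over $t$ (from $C^+$ to $C^-$) replaces the simplices $\{l\cup\sigma:\sigma\in C^+,l\in L\}$ by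 the simplices $\{l\cup\tau:\tau\in C^-,l\in L\}$; the flip from $C^-$ to $C^+$ is defined in the same way with the roles interchanged. Two triangulations differ by a bistellar flip if one is obtained from the other in this way for some circuit $t$. *)

theory Defs
  imports "HOL-Analysis.Analysis" "HOL-Library.Poly_Mapping"
begin

section \<open>The polynomial ring and its ideals\<close>

text \<open>Exponent vectors of monomials are elements of \<open>nat ^ 'n\<close>, where the finite type \<open>'n\<close> indexes
  the variables. Their library order is componentwise, so \<open>u < v\<close> means that \<open>u \<le> v\<close> in every
  component and \<open>u \<noteq> v\<close>. The convolution product of \<open>Poly_Mapping\<close> makes \<open>('n, 'k) mpoly\<close> the
  commutative polynomial ring in these variables.\<close>

type_synonym ('n, 'k) mpoly = "(nat ^ 'n) \<Rightarrow>\<^sub>0 'k"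

definition monom :: "nat ^ 'n \<Rightarrow> ('n::finite, 'k::field) mpoly" where
  "monom u = Poly_Mapping.single u 1"

definition var :: "'n \<Rightarrow> ('n::finite, 'k::field) mpoly" where
  "var i = monom (axis i 1)"

definition const :: "'k \<Rightarrow> ('n::finite, 'k::field) mpoly" where
  "const c = Poly_Mapping.single 0 c"

text \<open>Ideals of a commutative ring are its submodules: \<open>ideal.subspace I\<close> says that \<open>I\<close> is an ideal,
  and \<open>ideal.span B\<close> is the ideal generated by \<open>B\<close>.\<close>

global_interpretation ideal: module "(*) :: 'a::comm_ring_1 \<Rightarrow> 'a \<Rightarrow> 'a"
  by standard (simp_all add: algebra_simps)

definition rad :: "'a::comm_ring_1 set \<Rightarrow> 'a set" where
  "rad I = {f. \<exists>m::nat. f ^ m \<in> I}"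


section \<open>Graded ideals\<close>

text \<open>The degree \<open>A u\<close> of the monomial with exponent \<open>u\<close>; the variable \<open>i\<close> has the \<open>i\<close>-th column
  of \<open>A\<close> as its degree.\<close>

definition mdeg :: "int ^ 'n ^ 'm \<Rightarrow> nat ^ 'n \<Rightarrow> int ^ 'm::finite" where
  "mdeg A u = A *v (\<chi> i. int (u $ i))"

definition graded_piece :: "int ^ 'n ^ 'm \<Rightarrow> int ^ 'm \<Rightarrow> ('n::finite, 'k::field) mpoly set" where
  "graded_piece A b = {f. \<forall>u \<in> Poly_Mapping.keys f. mdeg A u = b}"

definition homogeneous_ideal ::
    "int ^ 'n ^ 'm \<Rightarrow> ('n::finite, 'k::field) mpoly set \<Rightarrow> bool" where
  "homogeneous_ideal A I \<longleftrightarrow>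
     (\<exists>B. (\<forall>f \<in> B. \<exists>b. f \<in> graded_piece A b) \<and> I = ideal.span B)"

text \<open>\<open>quotient_dim V I m\<close>: the image of the \<open>k\<close>-subspace \<open>V\<close> in the quotient by \<open>I\<close>, i.e.
  \<open>V / (V \<inter> I)\<close>, has a \<open>k\<close>-basis with \<open>m\<close> elements, namely the classes of the elements of \<open>B\<close>.\<close>

definition quotient_dim ::
    "('n::finite, 'k::field) mpoly set \<Rightarrow> ('n, 'k) mpoly set \<Rightarrow> nat \<Rightarrow> bool" where
  "quotient_dim V I m \<longleftrightarrow>
     (\<exists>B. finite B \<and> card B = m \<and> B \<subseteq> V \<and>
        (\<forall>c. (\<Sum>f\<in>B. const (c f) * f) \<in> I \<longrightarrow> (\<forall>f\<in>B. c f = 0)) \<and>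
        (\<forall>g\<in>V. \<exists>c. g - (\<Sum>f\<in>B. const (c f) * f) \<in> I))"

definition A_graded :: "int ^ 'n ^ 'm \<Rightarrow> ('n::finite, 'k::field) mpoly set \<Rightarrow> bool" where
  "A_graded A I \<longleftrightarrow>
     homogeneous_ideal A I \<and>
     (\<forall>b. quotient_dim (graded_piece A b) I (if b \<in> range (mdeg A) then 1 else 0))"

definition monomial_ideal :: "('n::finite, 'k::field) mpoly set \<Rightarrow> bool" where
  "monomial_ideal I \<longleftrightarrow> (\<exists>U. I = ideal.span (monom ` U))"

definition monomial_A_graded ::
    "int ^ 'n ^ 'm \<Rightarrow> ('n::finite, 'k::field) mpoly set \<Rightarrow> bool" where
  "monomial_A_graded A I \<longleftrightarrow> A_graded A I \<and> monomial_ideal I"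


section \<open>Graver binomials and flips of ideals\<close>

text \<open>A binomial is represented by its pair of exponents; the predicate is symmetric in them, which
  accounts for the sign.\<close>

definition graver :: "int ^ 'n ^ 'm \<Rightarrow> nat ^ 'n \<Rightarrow> nat ^ 'n \<Rightarrow> bool" where
  "graver A u v \<longleftrightarrow>
     u \<noteq> v \<and> mdeg A u = mdeg A v \<and>
     \<not> (\<exists>u' v'. u' \<noteq> 0 \<and> v' \<noteq> 0 \<and> mdeg A u' = mdeg A v' \<and> u' < u \<and> v' < v)"

text \<open>Minimality with respect to divisibility; for monomial ideals these are the minimal
  generators.\<close>

definition minimal_generator :: "('n::finite, 'k::field) mpoly set \<Rightarrow> nat ^ 'n \<Rightarrow> bool" where
  "minimal_generator I u \<longleftrightarrow> monom u \<in> I \<and> (\<forall>w. w < u \<longrightarrow> monom w \<notin> I)"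

definition ideal_flip ::
    "int ^ 'n ^ 'm \<Rightarrow> ('n::finite, 'k::field) mpoly set \<Rightarrow> nat ^ 'n \<Rightarrow> nat ^ 'n \<Rightarrow>
     ('n, 'k) mpoly set" where
  "ideal_flip A I u v =
     ideal.span ({monom c |c. \<exists>d. graver A c d \<and> (monom c :: ('n, 'k) mpoly) \<in> I \<and>
                      (monom d :: ('n, 'k) mpoly) \<notin> I \<and> c \<noteq> u} \<union> {monom v})"

definition flippable ::
    "int ^ 'n ^ 'm \<Rightarrow> ('n::finite, 'k::field) mpoly set \<Rightarrow> nat ^ 'n \<Rightarrow> nat ^ 'n \<Rightarrow> bool" where
  "flippable A I u v \<longleftrightarrow>
     graver A u v \<and> minimal_generator I u \<and> monom v \<notin> I \<and>
     monomial_A_graded A (ideal_flip A I u v)"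


section \<open>Point configurations and triangulations\<close>

text \<open>The matrix whose columns are the points, with an additional row of ones (indexed by
  \<open>None\<close>).\<close>

definition homogenized_matrix :: "('n::finite \<Rightarrow> int ^ 'd) \<Rightarrow> int ^ 'n ^ ('d::finite option)" where
  "homogenized_matrix a = (\<chi> r i. case r of None \<Rightarrow> 1 | Some s \<Rightarrow> a i $ s)"

definition full_row_rank :: "int ^ 'n::finite ^ 'm::finite \<Rightarrow> bool" where
  "full_row_rank A \<longleftrightarrow> rank (map_matrix rat_of_int A) = CARD('m)"

definition real_point :: "int ^ 'd::finite \<Rightarrow> real ^ 'd" where
  "real_point p = (\<chi> r. real_of_int (p $ r))"

text \<open>Triangulations are represented by the index sets of the vertex sets of their simplices. The
  empty simplex belongs to every simplicial complex considered here.\<close>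

definition is_triangulation :: "('n::finite \<Rightarrow> int ^ 'd::finite) \<Rightarrow> 'n set set \<Rightarrow> bool" where
  "is_triangulation a \<Delta> \<longleftrightarrow>
     (\<exists>\<C>. simplicial_complex \<C> \<and>
          \<Union>\<C> = convex hull (range (\<lambda>i. real_point (a i))) \<and>
          (\<forall>S\<in>\<C>. {x. x extreme_point_of S} \<subseteq> range (\<lambda>i. real_point (a i))) \<and>
          \<Delta> = (\<lambda>S. {i. real_point (a i) extreme_point_of S}) ` \<C>)"

definition stanley_reisner :: "('n::finite, 'k::field) mpoly set \<Rightarrow> 'n set set" where
  "stanley_reisner J = {\<sigma>. (\<Prod>i\<in>\<sigma>. var i) \<notin> J}"


section \<open>Bistellar flips\<close>

definition support :: "int ^ 'n \<Rightarrow> 'n::finite set" where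
  "support t = {i. t $ i \<noteq> 0}"

definition circuit :: "int ^ 'n ^ 'm::finite \<Rightarrow> int ^ 'n::finite \<Rightarrow> bool" where
  "circuit A t \<longleftrightarrow>
     t \<noteq> 0 \<and> A *v t = 0 \<and>
     \<not> (\<exists>s. s \<noteq> 0 \<and> A *v s = 0 \<and> support s \<subset> support t) \<and>
     (GCD i\<in>UNIV. t $ i) = 1"

definition circuit_plus :: "int ^ 'n \<Rightarrow> 'n::finite set set" where
  "circuit_plus t = {support t - {i} |i. t $ i > 0}"

definition circuit_minus :: "int ^ 'n \<Rightarrow> 'n::finite set set" where
  "circuit_minus t = {support t - {i} |i. t $ i < 0}"

text \<open>\<open>circuit_plus t\<close> and \<open>circuit_minus t\<close> are the sets of maximal simplices; the triangulations
  \<open>C\<^sup>+\<close> and \<open>C\<^sup>-\<close> consist of all their faces.\<close>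

definition faces :: "'n set set \<Rightarrow> 'n set set" where
  "faces F = {\<sigma>. \<exists>\<rho>\<in>F. \<sigma> \<subseteq> \<rho>}"

definition link :: "'n set set \<Rightarrow> 'n set \<Rightarrow> 'n set set" where
  "link \<Delta> \<sigma> = {\<tau>. \<tau> \<inter> \<sigma> = {} \<and> \<tau> \<union> \<sigma> \<in> \<Delta>}"

text \<open>\<open>\<Delta>'\<close> arises from \<open>\<Delta>\<close> by replacing the complex with maximal simplices \<open>F\<close> by the one with
  maximal simplices \<open>G\<close>.\<close>

definition flips_to :: "'n set set \<Rightarrow> 'n set set \<Rightarrow> 'n set set \<Rightarrow> 'n set set \<Rightarrow> bool" where
  "flips_to F G \<Delta> \<Delta>' \<longleftrightarrow>
     faces F \<subseteq> \<Delta> \<and>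
     (\<exists>L. (\<forall>\<rho>\<in>F. link \<Delta> \<rho> = L) \<and>
          \<Delta>' = (\<Delta> - {l \<union> \<sigma> |l \<sigma>. l \<in> L \<and> \<sigma> \<in> faces F}) \<union> {l \<union> \<tau> |l \<tau>. l \<in> L \<and> \<tau> \<in> faces G})"

definition bistellar_flip :: "('n::finite \<Rightarrow> int ^ 'd::finite) \<Rightarrow> 'n set set \<Rightarrow> 'n set set \<Rightarrow> bool"
  where
  "bistellar_flip a \<Delta> \<Delta>' \<longleftrightarrow>
     (\<exists>t. circuit (homogenized_matrix a) t \<and>
          (flips_to (circuit_plus t) (circuit_minus t) \<Delta> \<Delta>' \<or>
           flips_to (circuit_minus t) (circuit_plus t) \<Delta> \<Delta>'))"

definition differ_by_bistellar_flip ::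
    "('n::finite \<Rightarrow> int ^ 'd::finite) \<Rightarrow> 'n set set \<Rightarrow> 'n set set \<Rightarrow> bool" where
  "differ_by_bistellar_flip a \<Delta> \<Delta>' \<longleftrightarrow>
     is_triangulation a \<Delta> \<and> is_triangulation a \<Delta>' \<and>
     (bistellar_flip a \<Delta> \<Delta>' \<or> bistellar_flip a \<Delta>' \<Delta>)"

end

theory Submission
  imports Defs
begin

text \<open>The standard monomials of \<open>I\<close> form a down-closed set of exponents with exactly one element in
  every fiber of \<open>A\<close>, and \<open>\<sigma> \<in> \<Delta>(rad I)\<close> means that all of \<open>\<nat>\<^sup>\<sigma>\<close> is standard. Hence points of
  \<open>\<nat>A\<close> have at most one representation supported on \<open>\<Delta>(rad I)\<close>, and a subsequence argument on the
  standard representatives of the multiples of a degree \<open>b\<close> shows that some multiple of \<open>b\<close> has one.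
  Simultaneous Diophantine approximation (for the intersections of simplices) and density (for the
  covering) carry this over to real points, which gives a triangulation.

  Let \<open>\<Delta>\<close> and \<open>\<Delta>'\<close> be the complexes of \<open>I\<close> and of its flip, \<open>P = supp u\<close> and \<open>Q = supp v\<close>. The
  simplices of \<open>\<Delta>\<close> outside \<open>\<Delta>'\<close> are those containing \<open>Q\<close>, and those of \<open>\<Delta>'\<close> outside \<open>\<Delta>\<close> are those
  containing \<open>P\<close>. Comparing the two representations of points near a simplex \<open>\<sigma> \<supseteq> Q\<close> shows
  \<open>P \<union> (\<sigma> - {i}) \<in> \<Delta>'\<close> for every \<open>i \<in> Q\<close>, and symmetrically. These exchanges make \<open>u - v\<close> a multiple
  of a circuit and show that \<open>\<Delta>\<close> and \<open>\<Delta>'\<close> differ by the flip over it.\<close>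


section \<open>Complexes of standard monomials\<close>

definition msupp :: "nat ^ 'n \<Rightarrow> 'n::finite set" where
  "msupp u = {i. u $ i \<noteq> 0}"

text \<open>Abstracts the standard monomials of a monomial \<open>A\<close>-graded ideal. Ring and
  field do not reappear before the last section.\<close>

definition standard_section :: "int ^ 'n ^ 'm \<Rightarrow> (nat ^ 'n::finite) set \<Rightarrow> bool" where
  "standard_section (A :: int ^ 'n ^ 'm::finite) M \<longleftrightarrow>
     (\<forall>w\<in>M. \<forall>w'\<le>w. w' \<in> M) \<and> (\<forall>u. \<exists>!w. w \<in> M \<and> mdeg A w = mdeg A u)"

text \<open>For the standard monomials of \<open>I\<close> this is the Stanley-Reisner complex of
  the radical, phrased without taking powers.\<close>

definition face_complex :: "(nat ^ 'n::finite) set \<Rightarrow> 'n set set" where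
  "face_complex M = {\<sigma>. \<forall>w. msupp w \<subseteq> \<sigma> \<longrightarrow> w \<in> M}"

text \<open>The factor \<open>k\<close> is there because the simplices need not be unimodular.\<close>

definition simplicial_fan :: "int ^ 'n ^ 'm \<Rightarrow> 'n::finite set set \<Rightarrow> bool" where
  "simplicial_fan (A :: int ^ 'n ^ 'm::finite) \<Delta> \<longleftrightarrow>
     (\<forall>\<sigma>\<in>\<Delta>. \<forall>\<tau>\<subseteq>\<sigma>. \<tau> \<in> \<Delta>) \<and>
     (\<forall>p q. msupp p \<in> \<Delta> \<longrightarrow> msupp q \<in> \<Delta> \<longrightarrow> mdeg A p = mdeg A q \<longrightarrow> p = q) \<and>
     (\<forall>p. \<exists>k>0. \<exists>q. msupp q \<in> \<Delta> \<and> mdeg A q = mdeg A (k *s p))"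

lemma simplicial_fan_subset:
  "simplicial_fan A \<Delta> \<Longrightarrow> \<sigma> \<in> \<Delta> \<Longrightarrow> \<tau> \<subseteq> \<sigma> \<Longrightarrow> \<tau> \<in> \<Delta>"
  unfolding simplicial_fan_def by blast

lemma simplicial_fan_unique:
  "simplicial_fan A \<Delta> \<Longrightarrow> msupp p \<in> \<Delta> \<Longrightarrow> msupp q \<in> \<Delta> \<Longrightarrow> mdeg A p = mdeg A q \<Longrightarrow> p = q"
  unfolding simplicial_fan_def by blast

lemma simplicial_fan_exists:
  assumes "simplicial_fan A \<Delta>"
  obtains k q where "k > 0" "msupp q \<in> \<Delta>" "mdeg A q = mdeg A (k *s p)"
proof -
  have "\<exists>k>0. \<exists>q. msupp q \<in> \<Delta> \<and> mdeg A q = mdeg A (k *s p)"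
    using assms unfolding simplicial_fan_def by (elim conjE allE)
  then show ?thesis using that by (elim exE conjE)
qed

section \<open>Degrees and supports of exponent vectors\<close>

lemma mdeg_component: "mdeg A u $ r = (\<Sum>i\<in>UNIV. A $ r $ i * int (u $ i))"
  by (simp add: mdeg_def matrix_vector_mult_def)

lemma mdeg_add: "mdeg A (u + w) = mdeg A u + mdeg A w"
  by (simp add: vec_eq_iff mdeg_component distrib_left sum.distrib)

lemma mdeg_scale: "mdeg A (k *s u) = int k *s mdeg A u"
proof -
  have "A $ r $ i * int ((k *s u) $ i) = int k * (A $ r $ i * int (u $ i))" for r i
    by (simp add: mult.left_commute)
  then show ?thesis
    by (simp only: vec_eq_iff mdeg_component vector_smult_component sum_distrib_left simp_thms)
qed

lemma msupp_add: "msupp (u + w) = msupp u \<union> msupp w"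
  by (auto simp: msupp_def)

lemma msupp_scale: "k > 0 \<Longrightarrow> msupp (k *s u) = msupp u"
  by (auto simp: msupp_def)

text \<open>Both alternatives survive passing to a further subsequence, so the coordinates of a
  sequence of vectors can be treated one after another.\<close>

definition constant_or_divergent :: "(nat \<Rightarrow> nat) \<Rightarrow> bool" where
  "constant_or_divergent g \<longleftrightarrow> (\<exists>c. \<forall>m. g m = c) \<or> filterlim g at_top sequentially"

lemma constant_or_divergent_subseq:
  assumes "constant_or_divergent g" "strict_mono s"
  shows "constant_or_divergent (\<lambda>m. g (s m))"
  using assms filterlim_compose[OF _ filterlim_subseq[OF assms(2)], of g at_top]
  unfolding constant_or_divergent_def by metis

text \<open>A sequence that does not diverge is below some bound infinitely often, and by pigeonhole
  it takes one value there infinitely often.\<close>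

lemma ex_constant_or_divergent_subseq:
  fixes g :: "nat \<Rightarrow> nat"
  obtains s where "strict_mono s" "constant_or_divergent (\<lambda>m. g (s m))"
proof (cases "filterlim g at_top sequentially")
  case True
  then show ?thesis using that[of "\<lambda>m. m"]
    by (simp add: constant_or_divergent_def strict_mono_Suc_iff)
next
  case False
  then obtain N where "\<exists>\<^sub>F m in sequentially. g m < N"
    by (auto simp: filterlim_at_top not_eventually not_le)
  then have inf: "infinite {m. g m < N}"
    by (simp add: frequently_cofinite flip: cofinite_eq_sequentially)
  have "finite (g ` {m. g m < N})"
    by (rule finite_subset[of _ "{..<N}"]) auto
  then obtain c where c: "infinite {m \<in> {m. g m < N}. g m = g c}"
    using pigeonhole_infinite[OF inf] by blast
  have "strict_mono (enumerate {m \<in> {m. g m < N}. g m = g c})"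
    using c by (rule strict_mono_enumerate)
  then show ?thesis
    using enumerate_in_set[OF c] by (intro that) (auto simp: constant_or_divergent_def)
qed

lemma coordinatewise_constant_or_divergent_subseq:
  fixes f :: "nat \<Rightarrow> nat ^ 'n::finite"
  obtains r where "strict_mono r" "\<And>i. constant_or_divergent (\<lambda>m. f (r m) $ i)"
proof -
  have "\<exists>r. strict_mono r \<and> (\<forall>i\<in>S. constant_or_divergent (\<lambda>m. f (r m) $ i))"
    if "finite S" for S
    using that
  proof (induction S rule: finite_induct)
    case empty
    show ?case using strict_mono_Suc_iff[of "\<lambda>m. m"] by auto
  next
    case (insert j S)
    then obtain r where r: "strict_mono r" "\<forall>i\<in>S. constant_or_divergent (\<lambda>m. f (r m) $ i)"
      by blast
    obtain s where s: "strict_mono s" "constant_or_divergent (\<lambda>m. f (r (s m)) $ j)"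
      using ex_constant_or_divergent_subseq[of "\<lambda>m. f (r m) $ j"] by blast
    have "\<forall>i\<in>S. constant_or_divergent (\<lambda>m. f (r (s m)) $ i)"
      using r(2) constant_or_divergent_subseq[OF _ s(1)] by fastforce
    moreover have "strict_mono (\<lambda>m. r (s m))"
      using strict_mono_o[OF r(1) s(1)] by (simp add: o_def)
    ultimately show ?case using s(2) by (intro exI[of _ "\<lambda>m. r (s m)"]) simp
  qed
  from this[of UNIV] show ?thesis using that by auto
qed

text \<open>Existence comes from the standard representatives \<open>f m\<close> of the multiples
  \<open>m *s p\<close>. Along a subsequence the coordinates in \<open>\<sigma>\<close> diverge and
  the others are constant, so a suitable difference of two terms is supported on
  \<open>\<sigma>\<close> and has a multiple of the degree of \<open>p\<close>.\<close>

lemma simplicial_fan_face_complex: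
  assumes M: "standard_section A M"
  shows "simplicial_fan A (face_complex M)"
  unfolding simplicial_fan_def
proof (intro conjI ballI allI impI)
  fix \<sigma> \<tau> assume "\<sigma> \<in> face_complex M" "\<tau> \<subseteq> \<sigma>"
  then show "\<tau> \<in> face_complex M" unfolding face_complex_def by blast
next
  fix p q assume "msupp p \<in> face_complex M" "msupp q \<in> face_complex M" "mdeg A p = mdeg A q"
  then show "p = q" using M unfolding standard_section_def face_complex_def by blast
next
  fix p
  have "\<exists>w. w \<in> M \<and> mdeg A w = mdeg A (m *s p)" for m
    using M unfolding standard_section_def by blast
  then obtain f where f: "\<And>m. f m \<in> M" "\<And>m. mdeg A (f m) = mdeg A (m *s p)" by metis
  obtain r where r: "strict_mono r" and alt:
    "\<And>i. constant_or_divergent (\<lambda>m. f (r m) $ i)"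
    using coordinatewise_constant_or_divergent_subseq[of f] by blast
  define \<sigma> where "\<sigma> = {i. filterlim (\<lambda>m. f (r m) $ i) at_top sequentially}"
  have large: "\<forall>\<^sub>F m in sequentially. \<forall>i\<in>\<sigma>. w $ i \<le> f (r m) $ i" for w :: "nat ^ 'a"
    by (subst eventually_ball_finite_distrib) (auto simp: \<sigma>_def filterlim_at_top)
  \<comment> \<open>Any exponent supported on \<open>\<sigma>\<close> lies below some
    \<open>f (r m)\<close>, and \<open>M\<close> is down-closed.\<close>
  have \<sigma>: "\<sigma> \<in> face_complex M"
    unfolding face_complex_def
  proof (safe)
    fix w :: "nat ^ 'a" assume w: "msupp w \<subseteq> \<sigma>"
    obtain m where "\<forall>i\<in>\<sigma>. w $ i \<le> f (r m) $ i"
      using eventually_happens[OF large] by force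
    then have "w \<le> f (r m)" using w unfolding less_eq_vec_def msupp_def
      by (metis (mono_tags) mem_Collect_eq subsetD zero_le)
    then show "w \<in> M" using M f(1) unfolding standard_section_def by blast
  qed
  \<comment> \<open>A late term dominates term 0 on \<open>\<sigma>\<close> and agrees with it
    elsewhere, so the truncated difference \<open>q\<close> is a true one.\<close>
  obtain m where m: "m > 0" "\<forall>i\<in>\<sigma>. f (r 0) $ i \<le> f (r m) $ i"
    using eventually_happens[OF eventually_conj[OF eventually_gt_at_top[of 0] large[of "f (r 0)"]]] by auto
  define q where "q = f (r m) - f (r 0)"
  have const: "f (r m) $ i = f (r 0) $ i" if "i \<notin> \<sigma>" for i
    using alt[of i] that unfolding \<sigma>_def constant_or_divergent_def by auto
  have "f (r 0) $ i \<le> f (r m) $ i" for i using m(2) const[of i] by (cases "i \<in> \<sigma>") auto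
  then have eq: "f (r m) = f (r 0) + q" unfolding q_def vec_eq_iff by simp
  have "msupp q \<subseteq> \<sigma>" using const by (force simp: q_def msupp_def)
  then have "msupp q \<in> face_complex M" using \<sigma> unfolding face_complex_def by blast
  moreover have rm: "r 0 < r m" using r m(1) by (simp add: strict_mono_less)
  moreover have "mdeg A q = mdeg A ((r m - r 0) *s p)"
    using f(2)[of "r m"] f(2)[of "r 0"] rm unfolding eq mdeg_add mdeg_scale
    by (simp add: vec_eq_iff of_nat_diff algebra_simps)
  ultimately show "\<exists>k>0. \<exists>q. msupp q \<in> face_complex M \<and> mdeg A q = mdeg A (k *s p)"
    by (metis zero_less_diff)
qed

section \<open>Exchanges and bistellar flips\<close>

text \<open>The point \<open>v + e\<close> in the cone over \<open>\<sigma>\<close>, where \<open>e\<close> is the indicator of \<open>\<sigma> - {i}\<close>, has a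
  multiple with a representation \<open>p\<close> over \<open>\<Delta>'\<close>. Since \<open>A u = A v\<close>, equal multiples of \<open>v\<close> and \<open>u\<close> can be
  subtracted from the two sides until one of the two is used up; what remains is supported
  on simplices of a common complex and therefore agrees.\<close>

lemma exchange_face:
  assumes fan: "simplicial_fan A \<Delta>" "simplicial_fan A \<Delta>'"
    and deg: "mdeg A u = mdeg A v"
    and u: "msupp u \<notin> \<Delta>" and v: "msupp v \<notin> \<Delta>'"
    and common: "\<And>\<sigma>. \<sigma> \<in> \<Delta> \<Longrightarrow> \<not> msupp v \<subseteq> \<sigma> \<Longrightarrow> \<sigma> \<in> \<Delta>'"
      "\<And>\<sigma>. \<sigma> \<in> \<Delta>' \<Longrightarrow> \<not> msupp u \<subseteq> \<sigma> \<Longrightarrow> \<sigma> \<in> \<Delta>"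
    and \<sigma>: "\<sigma> \<in> \<Delta>" "msupp v \<subseteq> \<sigma>" and i: "i \<in> msupp v"
  shows "msupp u \<union> (\<sigma> - {i}) \<in> \<Delta>'"
proof -
  define e :: "nat ^ 'a" where "e = (\<chi> j. if j \<in> \<sigma> - {i} then 1 else 0)"
  have e: "msupp e = \<sigma> - {i}" by (auto simp: e_def msupp_def)
  have ve: "msupp (v + e) = \<sigma>" using \<sigma>(2) i by (auto simp: msupp_add e)
  have e\<Delta>: "msupp e \<in> \<Delta>" using simplicial_fan_subset[OF fan(1) \<sigma>(1)] e by auto
  then have e\<Delta>': "msupp e \<in> \<Delta>'" using common(1) e i by auto
  obtain k p where k: "k > 0" and p: "msupp p \<in> \<Delta>'" "mdeg A p = mdeg A (k *s (v + e))"
    using simplicial_fan_exists[OF fan(2), of "v + e"] by blast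
  \<comment> \<open>Otherwise the support of \<open>p\<close> would lie in \<open>\<Delta>\<close>
    as well; uniqueness there would give \<open>\<sigma> \<in> \<Delta>'\<close>, although
    \<open>\<sigma>\<close> contains the nonface \<open>msupp v\<close>.\<close>
  have up: "msupp u \<subseteq> msupp p"
  proof (rule ccontr)
    assume "\<not> msupp u \<subseteq> msupp p"
    then have "p = k *s (v + e)"
      using simplicial_fan_unique[OF fan(1) _ _ p(2)] common(2)[OF p(1)] \<sigma>(1) ve k
      by (simp add: msupp_scale del: vector_add_ldistrib)
    then have "\<sigma> \<in> \<Delta>'" using p(1) ve k by (simp add: msupp_scale del: vector_add_ldistrib)
    then show False using simplicial_fan_subset[OF fan(2) _ \<sigma>(2)] v by blast
  qed
  have "msupp u \<noteq> {}" using u simplicial_fan_subset[OF fan(1) \<sigma>(1)] by auto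
  \<comment> \<open>A ratio test: \<open>j\<close> is where subtracting multiples of
    \<open>u\<close> from \<open>p\<close> first reaches zero. Scaling \<open>p\<close> by
    \<open>u $ j\<close> keeps the largest such multiple integral.\<close>
  then obtain j where j: "j \<in> msupp u"
    and jmin: "\<And>l. l \<in> msupp u \<Longrightarrow> real (p $ j) / real (u $ j) \<le> real (p $ l) / real (u $ l)"
    using arg_min_if_finite(1)[of "msupp u" "\<lambda>l. real (p $ l) / real (u $ l)"]
      arg_min_least[of "msupp u" _ "\<lambda>l. real (p $ l) / real (u $ l)"] by auto
  have uj: "u $ j > 0" using j by (simp add: msupp_def)
  have le: "p $ j * u $ l \<le> u $ j * p $ l" for l
  proof (cases "l \<in> msupp u")
    case True
    then have "real (p $ j) * real (u $ l) \<le> real (p $ l) * real (u $ j)"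
      using jmin[OF True] uj by (simp add: msupp_def field_simps)
    then show ?thesis by (metis mult.commute of_nat_le_iff of_nat_mult)
  qed (simp add: msupp_def)
  define \<alpha> K where "\<alpha> = p $ j" and "K = u $ j * k"
  have K: "K > 0" using k uj by (simp add: K_def)
  have p': "mdeg A (u $ j *s p) = mdeg A (K *s (v + e))" "msupp (u $ j *s p) \<in> \<Delta>'"
    using p uj by (simp_all add: mdeg_scale K_def msupp_scale vec_eq_iff del: vector_add_ldistrib)
  show ?thesis
  proof (cases "\<alpha> < K")
    \<comment> \<open>Here \<open>u\<close> is used up first. The remainder misses \<open>j\<close>,
      so it is a face of both complexes; uniqueness in \<open>\<Delta>\<close> gives it support
      \<open>\<sigma>\<close>, which contradicts \<open>msupp v \<notin> \<Delta>'\<close>.\<close>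
    case True
    define r where "r = u $ j *s p - \<alpha> *s u"
    have eq: "u $ j *s p = \<alpha> *s u + r" using le by (simp add: r_def vec_eq_iff \<alpha>_def)
    have r: "msupp r \<subseteq> msupp (u $ j *s p)" unfolding eq msupp_add by simp
    then have r\<Delta>': "msupp r \<in> \<Delta>'" using simplicial_fan_subset[OF fan(2)] p' by blast
    have "j \<notin> msupp r" by (simp add: r_def msupp_def \<alpha>_def)
    then have r\<Delta>: "msupp r \<in> \<Delta>" using common(2)[OF r\<Delta>'] j by blast
    have "msupp ((K - \<alpha>) *s v + K *s e) = \<sigma>"
      using True K ve by (simp add: msupp_add msupp_scale)
    moreover have "mdeg A r = mdeg A ((K - \<alpha>) *s v + K *s e)"
      using p'(1) True unfolding eq mdeg_add mdeg_scale deg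
      by (simp add: vec_eq_iff of_nat_diff algebra_simps)
    ultimately have "msupp r = \<sigma>" using simplicial_fan_unique[OF fan(1) r\<Delta>] \<sigma>(1) by metis
    then show ?thesis using simplicial_fan_subset[OF fan(2) r\<Delta>'] \<sigma>(2) v by blast
  next
    \<comment> \<open>All \<open>K\<close> copies of \<open>v\<close> cancel. The remainder has the
      degree of \<open>K *s e\<close> and equals it by uniqueness in \<open>\<Delta>'\<close>, which
      identifies the support of \<open>p\<close>.\<close>
    case False
    define r where "r = u $ j *s p - K *s u"
    have "K * u $ l \<le> u $ j * p $ l" for l
      using le[of l] False order_trans[OF mult_right_mono[of K \<alpha> "u $ l"]] by (simp add: \<alpha>_def)
    then have eq: "u $ j *s p = K *s u + r" by (simp add: r_def vec_eq_iff)
    have "msupp r \<subseteq> msupp (u $ j *s p)" unfolding eq msupp_add by simp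
    then have r\<Delta>': "msupp r \<in> \<Delta>'" using simplicial_fan_subset[OF fan(2)] p' by blast
    have "mdeg A r = mdeg A (K *s e)"
      using p'(1) unfolding eq mdeg_add mdeg_scale deg
      by (simp add: vec_eq_iff algebra_simps)
    then have "r = K *s e" using simplicial_fan_unique[OF fan(2) r\<Delta>'] e\<Delta>' K by (simp add: msupp_scale)
    then have "msupp (u $ j *s p) = msupp u \<union> (\<sigma> - {i})"
      using eq K by (simp add: msupp_add msupp_scale e)
    then show ?thesis using p'(2) by simp
  qed
qed

text \<open>The positive and negative parts of \<open>s\<close> represent the same degree over
  \<open>\<Delta>\<close>. They may lie in different simplices, which later controls how simplices
  intersect.\<close>

lemma simplicial_fan_kernel:
  assumes fan: "simplicial_fan A \<Delta>" and s: "{i. s $ i > 0} \<in> \<Delta>" "{i. s $ i < 0} \<in> \<Delta>" "A *v s = 0"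
  shows "s = 0"
proof -
  define p q where "p = (\<chi> i. nat (s $ i))" and "q = (\<chi> i. nat (- s $ i))"
  have \<Delta>: "msupp p \<in> \<Delta>" "msupp q \<in> \<Delta>" using s(1,2) by (simp_all add: p_def q_def msupp_def not_le)
  have split: "s $ i = int (p $ i) - int (q $ i)" for i by (simp add: p_def q_def)
  have "mdeg A p - mdeg A q = A *v s"
    by (simp add: vec_eq_iff mdeg_component matrix_vector_mult_def split right_diff_distrib
        sum_subtractf)
  then have "p = q" using simplicial_fan_unique[OF fan \<Delta>] s(3) by simp
  then show ?thesis by (simp add: vec_eq_iff split)
qed

text \<open>Supplies the coprime entries that \<open>circuit\<close> demands, with a positive factor
  so that signs are kept.\<close>

lemma primitive_multiple:
  fixes z :: "int ^ 'n::finite"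
  assumes "z \<noteq> 0"
  obtains g t where "g > 0" "z = g *s t" "(GCD i\<in>UNIV. t $ i) = 1"
proof -
  define g where "g = (GCD i\<in>UNIV. z $ i)"
  define t where "t = (\<chi> i. z $ i div g)"
  have "g \<noteq> 0" using assms by (auto simp: g_def vec_eq_iff)
  then have g: "g > 0" by (simp add: g_def order_less_le)
  have "g dvd z $ i" for i unfolding g_def by simp
  then have z: "z = g *s t" by (simp add: vec_eq_iff t_def)
  have "g = Gcd ((*) g ` range (($) t))"
    by (subst (1) g_def) (simp add: z image_image)
  also have "\<dots> = g * (GCD i\<in>UNIV. t $ i)"
    using g by (simp add: Gcd_mult abs_mult)
  finally have "(GCD i\<in>UNIV. t $ i) = 1" using g by simp
  then show ?thesis using that g z by blast
qed

text \<open>The circuit is \<open>u - v\<close> made primitive, with \<open>P\<close> and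
  \<open>Q\<close> as positive and negative support. Exchanging from \<open>\<Delta>\<close> to
  \<open>\<Delta>'\<close> and back moves between the maximal simplices of \<open>C^+\<close>, so
  these share one link.\<close>

lemma flip_of_exchanges:
  assumes fan: "simplicial_fan A \<Delta>" "simplicial_fan A \<Delta>'"
    and deg: "mdeg A u = mdeg A v" and disj: "msupp u \<inter> msupp v = {}"
    and u: "msupp u \<notin> \<Delta>" and v: "msupp v \<notin> \<Delta>'"
    and common: "\<And>\<sigma>. \<sigma> \<in> \<Delta> \<Longrightarrow> \<not> msupp v \<subseteq> \<sigma> \<Longrightarrow> \<sigma> \<in> \<Delta>'"
      "\<And>\<sigma>. \<sigma> \<in> \<Delta>' \<Longrightarrow> \<not> msupp u \<subseteq> \<sigma> \<Longrightarrow> \<sigma> \<in> \<Delta>"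
    and "\<Delta> \<noteq> \<Delta>'"
  obtains t where "circuit A t" "flips_to (circuit_plus t) (circuit_minus t) \<Delta> \<Delta>'"
proof -
  define P Q T where "P = msupp u" and "Q = msupp v" and "T = P \<union> Q"
  note down = simplicial_fan_subset[OF fan(1)] simplicial_fan_subset[OF fan(2)]
  have P\<Delta>: "P \<notin> \<Delta>" and Q\<Delta>': "Q \<notin> \<Delta>'" and PQ: "P \<inter> Q = {}"
    using u v disj by (auto simp: P_def Q_def)
  note common = common[folded P_def Q_def]
  have ex1: "P \<union> (\<sigma> - {i}) \<in> \<Delta>'" if "\<sigma> \<in> \<Delta>" "Q \<subseteq> \<sigma>" "i \<in> Q" for \<sigma> i
    unfolding P_def
    by (rule exchange_face[OF fan deg u v common[unfolded P_def Q_def]])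
      (use that in \<open>auto simp: Q_def\<close>)
  have ex2: "Q \<union> (\<sigma> - {j}) \<in> \<Delta>" if "\<sigma> \<in> \<Delta>'" "P \<subseteq> \<sigma>" "j \<in> P" for \<sigma> j
    unfolding Q_def
    by (rule exchange_face[OF fan(2,1) deg[symmetric] v u common(2,1)[unfolded P_def Q_def]])
      (use that in \<open>auto simp: P_def\<close>)
  have "{} \<in> \<Delta>" using simplicial_fan_exists[OF fan(1)] down(1) by (metis empty_subsetI)
  then have "P \<noteq> {}" using P\<Delta> by auto
  have "{} \<in> \<Delta>'" using simplicial_fan_exists[OF fan(2)] down(2) by (metis empty_subsetI)
  then have "Q \<noteq> {}" using Q\<Delta>' by auto
  \<comment> \<open>A simplex in only one of the complexes contains \<open>Q\<close> if it belongs
    to \<open>\<Delta>\<close>; if it belongs to \<open>\<Delta>'\<close> it contains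
    \<open>P\<close>, and an exchange produces \<open>Q\<close>.\<close>
  have Q\<Delta>: "Q \<in> \<Delta>"
  proof (cases "\<Delta> \<subseteq> \<Delta>'")
    case True
    then obtain \<sigma> where "\<sigma> \<in> \<Delta>'" "\<sigma> \<notin> \<Delta>" using \<open>\<Delta> \<noteq> \<Delta>'\<close> by blast
    moreover obtain j where "j \<in> P" using \<open>P \<noteq> {}\<close> by blast
    ultimately show ?thesis using ex2[of \<sigma> j] common(2) down(1) by blast
  next
    case False
    then show ?thesis using common(1) down(1) by blast
  qed
  have TQ: "T - {i} \<in> \<Delta>'" if "i \<in> Q" for i
  proof -
    have "P \<union> (Q - {i}) = T - {i}" using that PQ by (auto simp: T_def)
    then show ?thesis using ex1[OF Q\<Delta> order_refl that] by simp
  qed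
  have TP: "T - {j} \<in> \<Delta>" if "j \<in> P" for j
  proof -
    obtain i where i: "i \<in> Q" using \<open>Q \<noteq> {}\<close> by blast
    have "Q \<union> (T - {i} - {j}) = T - {j}" using i that PQ by (auto simp: T_def)
    moreover have "P \<subseteq> T - {i}" using i PQ by (auto simp: T_def)
    ultimately show ?thesis using ex2[OF TQ[OF i] _ that] by simp
  qed

  define z :: "int ^ 'a" where "z = (\<chi> i. int (u $ i) - int (v $ i))"
  have z: "z $ i > 0 \<longleftrightarrow> i \<in> P" "z $ i < 0 \<longleftrightarrow> i \<in> Q" for i
    using PQ by (force simp: z_def P_def Q_def msupp_def)+
  then have "z \<noteq> 0" using \<open>P \<noteq> {}\<close> by auto
  then obtain g t where g: "g > 0" and zt: "z = g *s t" and gcd: "(GCD i\<in>UNIV. t $ i) = 1"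
    using primitive_multiple by blast
  have t: "t $ i > 0 \<longleftrightarrow> i \<in> P" "t $ i < 0 \<longleftrightarrow> i \<in> Q" for i
    using z[of i] g by (simp_all add: zt zero_less_mult_iff mult_less_0_iff)
  then have supp: "support t = T"
    by (auto simp: support_def T_def neq_iff t)
  have "A *v z = mdeg A u - mdeg A v"
    by (simp add: vec_eq_iff mdeg_component matrix_vector_mult_def z_def right_diff_distrib
        sum_subtractf)
  then have "A *v z = 0" using deg by simp
  moreover have "(A *v z) $ r = g * (A *v t) $ r" for r
    unfolding zt matrix_vector_mult_def
    by (simp only: vec_lambda_beta vector_smult_component sum_distrib_left mult.left_commute)
  ultimately have At: "A *v t = 0" using g by (simp add: vec_eq_iff)
  \<comment> \<open>A proper subset of \<open>T\<close> omits a point of \<open>P\<close> or of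
    \<open>Q\<close>, so it is a face of \<open>\<Delta>\<close> or of \<open>\<Delta>'\<close>,
    where no dependence exists.\<close>
  have "s = 0" if s: "A *v s = 0" "support s \<subset> T" for s
  proof -
    obtain i where i: "i \<in> T" "support s \<subseteq> T - {i}" using s(2) by blast
    then have "support s \<in> \<Delta> \<or> support s \<in> \<Delta>'"
      using TP[of i] TQ[of i] down[OF _ i(2)] by (auto simp: T_def)
    moreover have "{i. s $ i > 0} \<subseteq> support s" "{i. s $ i < 0} \<subseteq> support s"
      by (auto simp: support_def)
    ultimately show ?thesis using simplicial_fan_kernel[OF _ _ _ s(1)] fan down by metis
  qed
  moreover have "t \<noteq> 0" using \<open>z \<noteq> 0\<close> zt by auto
  ultimately have circuit: "circuit A t"
    using At gcd supp unfolding circuit_def by blast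
  have plus: "circuit_plus t = {T - {j} |j. j \<in> P}"
    and minus: "circuit_minus t = {T - {i} |i. i \<in> Q}"
    by (simp_all add: circuit_plus_def circuit_minus_def supp t)

  \<comment> \<open>The choice of \<open>j\<close> is immaterial: \<open>L1\<close> exchanges into
    \<open>\<Delta>'\<close>, and \<open>L2\<close> exchanges back to any other
    \<open>j\<close>.\<close>
  define L where "L = {\<tau>. \<tau> \<inter> T = {} \<and> (\<exists>j\<in>P. \<tau> \<union> (T - {j}) \<in> \<Delta>)}"
  have L1: "\<tau> \<union> (T - {i}) \<in> \<Delta>'" if \<tau>: "\<tau> \<in> L" and i: "i \<in> Q" for \<tau> i
  proof -
    obtain j where j: "j \<in> P" "\<tau> \<inter> T = {}" "\<tau> \<union> (T - {j}) \<in> \<Delta>"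
      using \<tau> by (auto simp: L_def)
    have "P \<union> (\<tau> \<union> (T - {j}) - {i}) = \<tau> \<union> (T - {i})"
      using j(1,2) i PQ by (auto simp: T_def)
    moreover have "Q \<subseteq> \<tau> \<union> (T - {j})" using j(1) PQ by (auto simp: T_def)
    ultimately show ?thesis using ex1[OF j(3) _ i] by simp
  qed
  have L2: "\<tau> \<union> (T - {j}) \<in> \<Delta>" if "\<tau> \<in> L" "j \<in> P" for \<tau> j
  proof -
    obtain i where i: "i \<in> Q" using \<open>Q \<noteq> {}\<close> by blast
    have "Q \<union> (\<tau> \<union> (T - {i}) - {j}) = \<tau> \<union> (T - {j})"
      using i that PQ by (auto simp: T_def L_def)
    moreover have "P \<subseteq> \<tau> \<union> (T - {i})" using i PQ by (auto simp: T_def)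
    ultimately show ?thesis using ex2[OF L1[OF that(1) i] _ that(2)] by simp
  qed
  \<comment> \<open>The link only requires disjointness from \<open>T - {j}\<close>; a member
    containing \<open>j\<close> would complete the nonface \<open>P\<close>.\<close>
  have link: "link \<Delta> (T - {j}) = L" if "j \<in> P" for j
  proof -
    have "j \<notin> \<tau>" if "\<tau> \<union> (T - {j}) \<in> \<Delta>" for \<tau>
    proof
      assume "j \<in> \<tau>"
      then have "P \<subseteq> \<tau> \<union> (T - {j})" by (auto simp: T_def)
      then show False using down(1)[OF that] P\<Delta> by blast
    qed
    then show ?thesis using that L2 unfolding link_def L_def by blast
  qed
  have face_plus: "\<rho> \<in> faces (circuit_plus t) \<longleftrightarrow> \<rho> \<subseteq> T \<and> \<not> P \<subseteq> \<rho>" for \<rho>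
    unfolding faces_def plus by (auto simp: T_def)
  have face_minus: "\<rho> \<in> faces (circuit_minus t) \<longleftrightarrow> \<rho> \<subseteq> T \<and> \<not> Q \<subseteq> \<rho>" for \<rho>
    unfolding faces_def minus by (auto simp: T_def)
  have dec: "\<sigma> = (\<sigma> - T) \<union> (\<sigma> \<inter> T)" for \<sigma> by blast
  let ?B = "{l \<union> \<sigma> |l \<sigma>. l \<in> L \<and> \<sigma> \<in> faces (circuit_plus t)}"
  let ?C = "{l \<union> \<tau> |l \<tau>. l \<in> L \<and> \<tau> \<in> faces (circuit_minus t)}"
  have C: "\<sigma> \<in> \<Delta>'" if \<sigma>: "\<sigma> \<in> ?C" for \<sigma>
  proof -
    obtain l \<tau> where l: "\<sigma> = l \<union> \<tau>" "l \<in> L" "\<tau> \<subseteq> T" "\<not> Q \<subseteq> \<tau>"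
      using \<sigma> unfolding face_minus by blast
    then obtain i where "i \<in> Q" "i \<notin> \<tau>" by blast
    then show ?thesis using down(2)[OF L1[OF l(2)], of i \<sigma>] l by blast
  qed
  \<comment> \<open>Split \<open>\<sigma>\<close> along \<open>T\<close>: one exchange shows that
    \<open>\<sigma> - T\<close> is in \<open>L\<close>. For \<open>old\<close> below, two exchanges
    do the same.\<close>
  have new: "\<sigma> \<in> ?C" if \<sigma>: "\<sigma> \<in> \<Delta>'" "P \<subseteq> \<sigma>" for \<sigma>
  proof -
    obtain j where j: "j \<in> P" using \<open>P \<noteq> {}\<close> by blast
    have "(\<sigma> - T) \<union> (T - {j}) = Q \<union> (\<sigma> - {j})"
      using \<sigma>(2) j PQ by (auto simp: T_def)
    then have "(\<sigma> - T) \<union> (T - {j}) \<in> \<Delta>" using ex2[OF \<sigma> j] by simp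
    then have "\<sigma> - T \<in> L" using j unfolding L_def by blast
    moreover have "\<sigma> \<inter> T \<in> faces (circuit_minus t)"
      using down(2)[OF \<sigma>(1)] Q\<Delta>' by (auto simp: face_minus)
    ultimately show ?thesis using dec[of \<sigma>] by blast
  qed
  have old: "\<sigma> \<in> ?B" if \<sigma>: "\<sigma> \<in> \<Delta>" "Q \<subseteq> \<sigma>" for \<sigma>
  proof -
    obtain i j where i: "i \<in> Q" and j: "j \<in> P" using \<open>P \<noteq> {}\<close> \<open>Q \<noteq> {}\<close> by blast
    have "P \<union> (\<sigma> - {i}) \<in> \<Delta>'" using ex1[OF \<sigma> i] .
    then have "Q \<union> (P \<union> (\<sigma> - {i}) - {j}) \<in> \<Delta>" using ex2[OF _ _ j] by blast
    moreover have "(\<sigma> - T) \<union> (T - {j}) = Q \<union> (P \<union> (\<sigma> - {i}) - {j})"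
      using \<sigma>(2) i j PQ by (auto simp: T_def)
    ultimately have "(\<sigma> - T) \<union> (T - {j}) \<in> \<Delta>" by simp
    then have "\<sigma> - T \<in> L" using j unfolding L_def by blast
    moreover have "\<sigma> \<inter> T \<in> faces (circuit_plus t)"
      using down(1)[OF \<sigma>(1)] P\<Delta> by (auto simp: face_plus)
    ultimately show ?thesis using dec[of \<sigma>] by blast
  qed
  \<comment> \<open>Boundary simplices of the flipped region are removed with \<open>?B\<close> and
    must return with \<open>?C\<close>.\<close>
  have kept: "\<sigma> \<in> ?C" if B: "\<sigma> \<in> ?B" and \<sigma>: "\<sigma> \<in> \<Delta>'" for \<sigma>
  proof -
    obtain l \<tau> where l: "\<sigma> = l \<union> \<tau>" "l \<in> L" "\<tau> \<subseteq> T"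
      using B unfolding face_plus by blast
    have "\<not> Q \<subseteq> \<tau>" using down(2)[OF \<sigma>, of Q] Q\<Delta>' l(1) by blast
    then show ?thesis using l face_minus by blast
  qed
  have "\<Delta>' = (\<Delta> - ?B) \<union> ?C"
  proof (intro set_eqI iffI)
    fix \<sigma> assume \<sigma>: "\<sigma> \<in> \<Delta>'"
    show "\<sigma> \<in> (\<Delta> - ?B) \<union> ?C"
    proof (cases "P \<subseteq> \<sigma>")
      case False
      then show ?thesis using common(2)[OF \<sigma>] kept[OF _ \<sigma>] by (cases "\<sigma> \<in> ?B") blast+
    qed (use new[OF \<sigma>] in blast)
  next
    fix \<sigma> assume "\<sigma> \<in> (\<Delta> - ?B) \<union> ?C"
    then consider "\<sigma> \<in> \<Delta>" "\<sigma> \<notin> ?B" | "\<sigma> \<in> ?C" by (elim UnE DiffE)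
    then show "\<sigma> \<in> \<Delta>'"
      by cases (use old common(1) C in \<open>blast+\<close>)
  qed
  moreover have "faces (circuit_plus t) \<subseteq> \<Delta>"
    using TP down(1) unfolding faces_def plus by blast
  moreover have "\<forall>\<rho>\<in>circuit_plus t. link \<Delta> \<rho> = L"
    using link unfolding plus by blast
  ultimately have "flips_to (circuit_plus t) (circuit_minus t) \<Delta> \<Delta>'"
    unfolding flips_to_def by (intro conjI exI[of _ L])
  then show ?thesis using that circuit by simp
qed


section \<open>From integer points to the triangulation\<close>

text \<open>By simultaneous Diophantine approximation some multiple \<open>q * c\<close> is close to
  an integer vector \<open>z\<close>. If the error is small enough, the integral entries of
  \<open>A *v z\<close> have absolute value below 1 and vanish, and no sign changes.\<close>

lemma integer_kernel_vector_with_signs: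
  fixes A :: "int ^ 'n::finite ^ 'm::finite" and c :: "'n \<Rightarrow> real"
  assumes c: "\<And>r. (\<Sum>i\<in>UNIV. real_of_int (A $ r $ i) * c i) = 0"
  obtains z where "A *v z = 0" "\<And>i. z $ i > 0 \<longleftrightarrow> c i > 0" "\<And>i. z $ i < 0 \<longleftrightarrow> c i < 0"
proof -
  \<comment> \<open>\<open>bA\<close> controls the error in every row of \<open>A\<close>;
    \<open>bc\<close> dominates every \<open>1 / \<bar>c i\<bar>\<close>, where vanishing
    coordinates contribute \<open>1 / 0 = 0\<close>.\<close>
  define bA bc where "bA = (\<Sum>r\<in>UNIV. \<Sum>i\<in>UNIV. \<bar>real_of_int (A $ r $ i)\<bar>)"
    and "bc = (\<Sum>i\<in>UNIV. 1 / \<bar>c i\<bar>)"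
  obtain N :: nat where N: "bA + bc + 1 < real N" using reals_Archimedean2 by blast
  have nonneg: "bA \<ge> 0" "bc \<ge> 0" by (simp_all add: bA_def bc_def sum_nonneg)
  then have N1: "N > 0" using N by (cases N) auto
  obtain h :: "nat \<Rightarrow> 'n" where h: "bij_betw h {0..<CARD('n)} UNIV"
    using ex_bij_betw_nat_finite[OF finite] by blast
  obtain q p where q: "0 < q"
    and p: "\<And>k. k < CARD('n) \<Longrightarrow> \<bar>of_int q * c (h k) - of_int (p k)\<bar> < 1 / real N"
    using Dirichlet_approx_simult[OF N1, of "CARD('n)" "\<lambda>k. c (h k)"] by metis
  define z :: "int ^ 'n" where "z = (\<chi> i. p (inv_into {0..<CARD('n)} h i))"
  have z: "\<bar>of_int q * c i - of_int (z $ i)\<bar> < 1 / real N" for i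
  proof -
    have "h (inv_into {0..<CARD('n)} h i) = i" "inv_into {0..<CARD('n)} h i < CARD('n)"
      using bij_betw_inv_into_right[OF h] bij_betw_inv_into[OF h]
      by (auto dest: bij_betwE)
    then show ?thesis using p[of "inv_into {0..<CARD('n)} h i"] by (simp add: z_def)
  qed
  have "(A *v z) $ r = 0" for r
  proof -
    have "real_of_int ((A *v z) $ r) =
        (\<Sum>i\<in>UNIV. real_of_int (A $ r $ i) * of_int (z $ i))
         - of_int q * (\<Sum>i\<in>UNIV. real_of_int (A $ r $ i) * c i)"
      by (simp add: matrix_vector_mult_def c)
    also have "\<dots> = (\<Sum>i\<in>UNIV. real_of_int (A $ r $ i) * (of_int (z $ i) - of_int q * c i))"
      unfolding sum_distrib_left right_diff_distrib sum_subtractf[symmetric]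
      by (simp only: mult.left_commute)
    also have "\<bar>\<dots>\<bar> \<le> (\<Sum>i\<in>UNIV. \<bar>real_of_int (A $ r $ i)\<bar> * (1 / real N))"
    proof (rule order_trans[OF sum_abs sum_mono])
      fix i
      have "\<bar>of_int (z $ i) - of_int q * c i\<bar> \<le> 1 / real N" using z[of i] by linarith
      then show "\<bar>real_of_int (A $ r $ i) * (of_int (z $ i) - of_int q * c i)\<bar>
          \<le> \<bar>real_of_int (A $ r $ i)\<bar> * (1 / real N)"
        unfolding abs_mult by (rule mult_left_mono) simp
    qed
    also have "\<dots> = (\<Sum>i\<in>UNIV. \<bar>real_of_int (A $ r $ i)\<bar>) / real N"
      by (simp add: sum_divide_distrib)
    also have "\<dots> \<le> bA / real N"
      unfolding bA_def by (intro divide_right_mono member_le_sum) (auto intro: sum_nonneg)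
    also have "\<dots> < 1" using N nonneg N1 by simp
    finally show ?thesis by linarith
  qed
  then have Az: "A *v z = 0" by (simp add: vec_eq_iff)
  have big: "1 / real N < \<bar>c i\<bar>" if "c i \<noteq> 0" for i
  proof -
    have "1 / \<bar>c i\<bar> \<le> bc" unfolding bc_def by (rule member_le_sum) auto
    then have "1 / \<bar>c i\<bar> < real N" using N nonneg by linarith
    then show ?thesis using that N1 by (simp add: field_simps)
  qed
  have q1: "\<bar>c i\<bar> \<le> \<bar>of_int q * c i\<bar>" for i
    using q mult_right_mono[of 1 "real_of_int q" "\<bar>c i\<bar>"] by (simp add: abs_mult)
  have "1 / real N \<le> 1" using N1 by simp
  then have "(z $ i > 0 \<longleftrightarrow> c i > 0) \<and> (z $ i < 0 \<longleftrightarrow> c i < 0)" for i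
  proof (cases "c i = 0")
    case True
    then have "\<bar>real_of_int (z $ i)\<bar> < 1" using z[of i] \<open>1 / real N \<le> 1\<close> by simp
    then show ?thesis using True by linarith
  next
    case False
    have sg: "c i > 0 \<Longrightarrow> of_int q * c i > 0" "c i < 0 \<Longrightarrow> of_int q * c i < 0"
      using q by (simp_all add: mult_pos_neg)
    have "(real_of_int (z $ i) > 0 \<longleftrightarrow> c i > 0) \<and> (real_of_int (z $ i) < 0 \<longleftrightarrow> c i < 0)"
      using z[of i] big[OF False] q1[of i] sg False by linarith
    then show ?thesis by simp
  qed
  then show ?thesis using that Az by blast
qed

text \<open>The row of ones turns real kernel vectors into affine dependences of the points.\<close>

lemma homogenized_matrix_sum:
  fixes a :: "'n::finite \<Rightarrow> int ^ 'd::finite" and c :: "'n \<Rightarrow> real"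
  shows "(\<forall>r. (\<Sum>i\<in>UNIV. real_of_int (homogenized_matrix a $ r $ i) * c i) = 0) \<longleftrightarrow>
    sum c UNIV = 0 \<and> (\<Sum>i\<in>UNIV. c i *\<^sub>R real_point (a i)) = 0"
proof
  assume L: "\<forall>r. (\<Sum>i\<in>UNIV. real_of_int (homogenized_matrix a $ r $ i) * c i) = 0"
  have "sum c UNIV = 0"
    using L[rule_format, of None] by (simp add: homogenized_matrix_def)
  moreover have "(\<Sum>i\<in>UNIV. c i *\<^sub>R real_point (a i)) $ s = 0" for s
    using L[rule_format, of "Some s"]
    by (simp add: homogenized_matrix_def real_point_def mult.commute)
  ultimately show "sum c UNIV = 0 \<and> (\<Sum>i\<in>UNIV. c i *\<^sub>R real_point (a i)) = 0"
    by (simp add: vec_eq_iff)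
next
  assume R: "sum c UNIV = 0 \<and> (\<Sum>i\<in>UNIV. c i *\<^sub>R real_point (a i)) = 0"
  show "\<forall>r. (\<Sum>i\<in>UNIV. real_of_int (homogenized_matrix a $ r $ i) * c i) = 0"
  proof
    fix r
    show "(\<Sum>i\<in>UNIV. real_of_int (homogenized_matrix a $ r $ i) * c i) = 0"
    proof (cases r)
      case None
      then show ?thesis using R by (simp add: homogenized_matrix_def)
    next
      case (Some s)
      have "(\<Sum>i\<in>UNIV. c i *\<^sub>R real_point (a i)) $ s = 0" using R by simp
      then show ?thesis using Some
        by (simp add: homogenized_matrix_def real_point_def mult.commute)
    qed
  qed
qed

lemma mdeg_homogenized_matrix_eq:
  assumes "mdeg (homogenized_matrix a) p = mdeg (homogenized_matrix a) q"
  shows "(\<Sum>i\<in>UNIV. real (p $ i)) = (\<Sum>i\<in>UNIV. real (q $ i))"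
    and "(\<Sum>i\<in>UNIV. real (p $ i) *\<^sub>R real_point (a i)) = (\<Sum>i\<in>UNIV. real (q $ i) *\<^sub>R real_point (a i))"
proof -
  have "(\<Sum>i\<in>UNIV. real_of_int (homogenized_matrix a $ r $ i) * (real (p $ i) - real (q $ i))) = 0"
    for r
  proof -
    have "real_of_int (mdeg (homogenized_matrix a) p $ r) = real_of_int (mdeg (homogenized_matrix a) q $ r)"
      using assms by simp
    then show ?thesis by (simp add: mdeg_component right_diff_distrib sum_subtractf)
  qed
  then show "(\<Sum>i\<in>UNIV. real (p $ i)) = (\<Sum>i\<in>UNIV. real (q $ i))"
    and "(\<Sum>i\<in>UNIV. real (p $ i) *\<^sub>R real_point (a i)) = (\<Sum>i\<in>UNIV. real (q $ i) *\<^sub>R real_point (a i))"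
    using homogenized_matrix_sum[of a "\<lambda>i. real (p $ i) - real (q $ i)"]
    by (simp_all add: sum_subtractf scaleR_left_diff_distrib)
qed

text \<open>The hypotheses on \<open>\<Delta>\<close> see only the signs of \<open>c\<close>, so
  \<open>c\<close> may be replaced by an integer kernel vector of the same signs.\<close>

lemma simplicial_fan_real_kernel:
  assumes fan: "simplicial_fan (homogenized_matrix a) \<Delta>"
    and c: "sum c UNIV = 0" "(\<Sum>i\<in>UNIV. c i *\<^sub>R real_point (a i)) = 0"
    and \<Delta>: "{i. c i > 0} \<in> \<Delta>" "{i. c i < 0} \<in> \<Delta>"
  shows "c i = 0"
proof -
  obtain z where z: "homogenized_matrix a *v z = 0"
    "\<And>i. z $ i > 0 \<longleftrightarrow> c i > 0" "\<And>i. z $ i < 0 \<longleftrightarrow> c i < 0"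
    using integer_kernel_vector_with_signs[of "homogenized_matrix a" c] homogenized_matrix_sum[of a c] c
    by metis
  have "z = 0" by (rule simplicial_fan_kernel[OF fan]) (use z \<Delta> in simp_all)
  then show ?thesis using z(2,3)[of i] by simp
qed

text \<open>Barycentric coordinates are extended by zero to all indices, so that coordinates over
  different simplices can be subtracted.\<close>

lemma convex_hull_image_finite_iff:
  fixes f :: "'n::finite \<Rightarrow> 'a::real_vector"
  assumes "inj f"
  shows "x \<in> convex hull (f ` \<sigma>) \<longleftrightarrow>
    (\<exists>c. (\<forall>i. 0 \<le> c i) \<and> (\<forall>i. i \<notin> \<sigma> \<longrightarrow> c i = 0) \<and> sum c UNIV = 1 \<and> (\<Sum>i\<in>UNIV. c i *\<^sub>R f i) = x)"
    (is "?L \<longleftrightarrow> ?R")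
proof
  assume ?L
  then obtain u where u: "\<forall>y\<in>f ` \<sigma>. 0 \<le> u y" "sum u (f ` \<sigma>) = 1" "(\<Sum>y\<in>f ` \<sigma>. u y *\<^sub>R y) = x"
    by (auto simp: convex_hull_finite)
  have inj: "inj_on f \<sigma>" using assms by (rule inj_on_subset) simp
  define c where "c = (\<lambda>i. if i \<in> \<sigma> then u (f i) else 0)"
  have "sum c UNIV = 1" using u(2) inj by (simp add: c_def sum.reindex flip: sum.inter_restrict)
  moreover have "(\<Sum>i\<in>UNIV. c i *\<^sub>R f i) = (\<Sum>i\<in>\<sigma>. u (f i) *\<^sub>R f i)"
    by (rule sum.mono_neutral_cong_right) (auto simp: c_def)
  then have "(\<Sum>i\<in>UNIV. c i *\<^sub>R f i) = x" using u(3) inj by (simp add: sum.reindex)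
  ultimately show ?R using u(1) by (intro exI[of _ c]) (auto simp: c_def)
next
  assume ?R
  then obtain c where c: "\<forall>i. 0 \<le> c i" "\<forall>i. i \<notin> \<sigma> \<longrightarrow> c i = 0" "sum c UNIV = 1"
    "(\<Sum>i\<in>UNIV. c i *\<^sub>R f i) = x" by blast
  have "sum c \<sigma> = 1" using c(2,3) by (metis (no_types, lifting) DiffD2 finite subset_UNIV sum.mono_neutral_left)
  then have "(\<Sum>i\<in>\<sigma>. c i *\<^sub>R f i) \<in> convex hull (f ` \<sigma>)"
    by (intro convex_sum) (use c in \<open>auto intro: hull_inc\<close>)
  moreover have "(\<Sum>i\<in>\<sigma>. c i *\<^sub>R f i) = x"
    unfolding c(4)[symmetric] by (rule sum.mono_neutral_left) (use c(2) in auto)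
  ultimately show ?L by simp
qed

lemma inj_real_point: "inj a \<Longrightarrow> inj (\<lambda>i. real_point (a i))"
  by (rule injI) (auto simp: real_point_def vec_eq_iff dest: injD)

section \<open>The geometric simplicial complex of a fan\<close>

context
  fixes a :: "'n::finite \<Rightarrow> int ^ 'd::finite" and \<Delta> :: "'n set set"
  assumes inj: "inj a" and fan: "simplicial_fan (homogenized_matrix a) \<Delta>"
begin

lemma fan_affine_independent:
  assumes "\<sigma> \<in> \<Delta>"
  shows "\<not> affine_dependent ((\<lambda>i. real_point (a i)) ` \<sigma>)"
proof
  assume "affine_dependent ((\<lambda>i. real_point (a i)) ` \<sigma>)"
  then obtain U where U: "sum U ((\<lambda>i. real_point (a i)) ` \<sigma>) = 0"
    "\<exists>v\<in>(\<lambda>i. real_point (a i)) ` \<sigma>. U v \<noteq> 0" "(\<Sum>v\<in>(\<lambda>i. real_point (a i)) ` \<sigma>. U v *\<^sub>R v) = 0"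
    by (auto simp: affine_dependent_explicit_finite)
  have inj': "inj_on (\<lambda>i. real_point (a i)) \<sigma>" using inj_real_point[OF inj] by (rule inj_on_subset) simp
  define c where "c = (\<lambda>i. if i \<in> \<sigma> then U (real_point (a i)) else 0)"
  have "sum c UNIV = 0" using U(1) inj' by (simp add: c_def sum.reindex flip: sum.inter_restrict)
  moreover have "(\<Sum>i\<in>UNIV. c i *\<^sub>R real_point (a i)) = (\<Sum>i\<in>\<sigma>. U (real_point (a i)) *\<^sub>R real_point (a i))"
    by (rule sum.mono_neutral_cong_right) (auto simp: c_def)
  then have "(\<Sum>i\<in>UNIV. c i *\<^sub>R real_point (a i)) = 0" using U(3) inj' by (simp add: sum.reindex)
  moreover have "{i. c i > 0} \<subseteq> \<sigma>" "{i. c i < 0} \<subseteq> \<sigma>" by (auto simp: c_def split: if_splits)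
  then have "{i. c i > 0} \<in> \<Delta>" "{i. c i < 0} \<in> \<Delta>" using simplicial_fan_subset[OF fan assms] by auto
  ultimately have "c i = 0" for i using simplicial_fan_real_kernel[OF fan] by blast
  then show False using U(2) unfolding c_def by (metis imageE)
qed

text \<open>Two barycentric representations of a point differ by a dependence with positive part in
  \<open>\<sigma>\<close> and negative part in \<open>\<tau>\<close>. Hence they agree and vanish
  off \<open>\<sigma> \<inter> \<tau>\<close>.\<close>

lemma fan_convex_hull_Int:
  assumes "\<sigma> \<in> \<Delta>" "\<tau> \<in> \<Delta>"
  shows "convex hull ((\<lambda>i. real_point (a i)) ` \<sigma>) \<inter> convex hull ((\<lambda>i. real_point (a i)) ` \<tau>)
    = convex hull ((\<lambda>i. real_point (a i)) ` (\<sigma> \<inter> \<tau>))"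
proof (rule antisym[OF subsetI])
  fix x assume "x \<in> convex hull ((\<lambda>i. real_point (a i)) ` \<sigma>) \<inter> convex hull ((\<lambda>i. real_point (a i)) ` \<tau>)"
  then obtain c d where
    c: "\<forall>i. 0 \<le> c i" "\<forall>i. i \<notin> \<sigma> \<longrightarrow> c i = 0" "sum c UNIV = 1" "(\<Sum>i\<in>UNIV. c i *\<^sub>R real_point (a i)) = x"
    and d: "\<forall>i. 0 \<le> d i" "\<forall>i. i \<notin> \<tau> \<longrightarrow> d i = 0" "sum d UNIV = 1" "(\<Sum>i\<in>UNIV. d i *\<^sub>R real_point (a i)) = x"
    unfolding Int_iff convex_hull_image_finite_iff[OF inj_real_point[OF inj]] by blast
  have "sum (\<lambda>i. c i - d i) UNIV = 0" using c d by (simp add: sum_subtractf)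
  moreover have "(\<Sum>i\<in>UNIV. (c i - d i) *\<^sub>R real_point (a i)) = 0"
    using c d by (simp add: sum_subtractf scaleR_left_diff_distrib)
  moreover have "{i. c i - d i > 0} \<subseteq> \<sigma>" "{i. c i - d i < 0} \<subseteq> \<tau>"
    using c(1,2) d(1,2) by (auto simp: not_less[symmetric])
  then have "{i. c i - d i > 0} \<in> \<Delta>" "{i. c i - d i < 0} \<in> \<Delta>"
    using simplicial_fan_subset[OF fan] assms by auto
  ultimately have "c i - d i = 0" for i by (rule simplicial_fan_real_kernel[OF fan])
  then have "c i = d i" for i by simp
  then have "\<forall>i. i \<notin> \<sigma> \<inter> \<tau> \<longrightarrow> c i = 0" using c(2) d(2) by (metis IntI)
  then show "x \<in> convex hull ((\<lambda>i. real_point (a i)) ` (\<sigma> \<inter> \<tau>))"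
    unfolding convex_hull_image_finite_iff[OF inj_real_point[OF inj]] using c by blast
qed (intro Int_greatest hull_mono image_mono; simp)

text \<open>Some multiple \<open>k *s p\<close> has the degree of a \<open>q\<close> supported on a
  simplex. Dividing \<open>q\<close> by its total weight, which is \<open>k\<close> times that of
  \<open>p\<close>, gives barycentric coordinates of the same point.\<close>

lemma fan_covers_rational:
  assumes "(\<Sum>i\<in>UNIV. real (p $ i)) > 0"
  shows "(\<Sum>i\<in>UNIV. (real (p $ i) / (\<Sum>i\<in>UNIV. real (p $ i))) *\<^sub>R real_point (a i))
    \<in> (\<Union>\<sigma>\<in>\<Delta>. convex hull ((\<lambda>i. real_point (a i)) ` \<sigma>))"
proof -
  define N where "N = (\<Sum>i\<in>UNIV. real (p $ i))"
  obtain k q where k: "k > 0" and q: "msupp q \<in> \<Delta>"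
    and deg: "mdeg (homogenized_matrix a) q = mdeg (homogenized_matrix a) (k *s p)"
    using simplicial_fan_exists[OF fan] by metis
  have kN: "real k * N > 0" using k assms by (simp add: N_def)
  have sum: "(\<Sum>i\<in>UNIV. real (q $ i)) = real k * N"
    using mdeg_homogenized_matrix_eq(1)[OF deg] by (simp add: N_def sum_distrib_left)
  have pts: "(\<Sum>i\<in>UNIV. real (q $ i) *\<^sub>R real_point (a i)) =
      real k *\<^sub>R (\<Sum>i\<in>UNIV. real (p $ i) *\<^sub>R real_point (a i))"
    using mdeg_homogenized_matrix_eq(2)[OF deg] by (simp add: scaleR_sum_right)
  define c where "c = (\<lambda>i. real (q $ i) / (real k * N))"
  have "(\<Sum>i\<in>UNIV. c i *\<^sub>R real_point (a i)) =
      (1 / (real k * N)) *\<^sub>R (\<Sum>i\<in>UNIV. real (q $ i) *\<^sub>R real_point (a i))"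
    by (simp add: c_def scaleR_sum_right)
  also have "\<dots> = (\<Sum>i\<in>UNIV. (real (p $ i) / N) *\<^sub>R real_point (a i))"
    unfolding pts using k by (simp add: scaleR_sum_right)
  finally have "(\<Sum>i\<in>UNIV. c i *\<^sub>R real_point (a i)) = (\<Sum>i\<in>UNIV. (real (p $ i) / N) *\<^sub>R real_point (a i))" .
  moreover have "sum c UNIV = 1" using sum kN by (simp add: c_def zero_less_mult_iff flip: sum_divide_distrib)
  moreover have "\<forall>i. 0 \<le> c i" using kN by (simp add: c_def)
  moreover have "\<forall>i. i \<notin> msupp q \<longrightarrow> c i = 0" by (simp add: c_def msupp_def)
  ultimately have "(\<Sum>i\<in>UNIV. (real (p $ i) / N) *\<^sub>R real_point (a i))
      \<in> convex hull ((\<lambda>i. real_point (a i)) ` msupp q)"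
    unfolding convex_hull_image_finite_iff[OF inj_real_point[OF inj]] by blast
  then show ?thesis using q unfolding N_def by blast
qed

text \<open>A finite union of compact hulls is closed, so it suffices to approximate a point of the
  hull by rational combinations.\<close>

lemma fan_covers:
  "(\<Union>\<sigma>\<in>\<Delta>. convex hull ((\<lambda>i. real_point (a i)) ` \<sigma>)) = convex hull (range (\<lambda>i. real_point (a i)))"
    (is "?K = ?H")
proof
  show "?K \<subseteq> ?H" by (auto intro: hull_mono[THEN subsetD, rotated])
next
  have "finite \<Delta>" by (rule finite_subset[of _ UNIV]) auto
  then have "closed ?K"
    by (intro closed_UN) (auto intro!: compact_imp_closed finite_imp_compact_convex_hull)
  show "?H \<subseteq> ?K"
  proof
    fix x assume "x \<in> ?H"
    then obtain c where c: "\<And>i. 0 \<le> c i" "sum c UNIV = 1" "(\<Sum>i\<in>UNIV. c i *\<^sub>R real_point (a i)) = x"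
      unfolding convex_hull_image_finite_iff[OF inj_real_point[OF inj]] by blast
    \<comment> \<open>Rounding up makes the total weight at least \<open>m\<close>, hence positive
      for \<open>m > 0\<close>, while each coordinate is off by at most 1.\<close>
    define p :: "nat \<Rightarrow> nat ^ 'n" where "p = (\<lambda>m. \<chi> i. nat \<lceil>real m * c i\<rceil>)"
    define N where "N = (\<lambda>m. \<Sum>i\<in>UNIV. real (p m $ i))"
    have p: "real m * c i \<le> real (p m $ i)" "real (p m $ i) \<le> real m * c i + 1" for m i
    proof -
      have "real (p m $ i) = of_int \<lceil>real m * c i\<rceil>" using c(1)[of i] by (simp add: p_def)
      then show "real m * c i \<le> real (p m $ i)" "real (p m $ i) \<le> real m * c i + 1"
        using ceiling_correct[of "real m * c i"] by linarith+
    qed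
    have plim: "(\<lambda>m. real (p m $ i) / real m) \<longlonglongrightarrow> c i" for i
    proof (rule tendsto_sandwich[where f = "\<lambda>_. c i" and h = "\<lambda>m. c i + 1 / real m"])
      show "(\<lambda>m. c i + 1 / real m) \<longlonglongrightarrow> c i"
        using tendsto_add[OF tendsto_const lim_1_over_n] by fastforce
      show "\<forall>\<^sub>F m in sequentially. c i \<le> real (p m $ i) / real m"
        using eventually_gt_at_top[of 0] by eventually_elim (use p in \<open>simp add: field_simps\<close>)
      show "\<forall>\<^sub>F m in sequentially. real (p m $ i) / real m \<le> c i + 1 / real m"
        using eventually_gt_at_top[of 0] by eventually_elim (use p in \<open>simp add: field_simps\<close>)
    qed simp
    have Nlim: "(\<lambda>m. N m / real m) \<longlonglongrightarrow> 1"
      unfolding N_def sum_divide_distrib c(2)[symmetric] by (intro tendsto_sum plim)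
    have "(\<lambda>m. (real (p m $ i) / real m) / (N m / real m)) \<longlonglongrightarrow> c i" for i
      using tendsto_divide[OF plim Nlim] by simp
    moreover have "\<forall>\<^sub>F m in sequentially.
        (real (p m $ i) / real m) / (N m / real m) = real (p m $ i) / N m" for i
      using eventually_gt_at_top[of 0] by eventually_elim simp
    ultimately have "(\<lambda>m. real (p m $ i) / N m) \<longlonglongrightarrow> c i" for i
      by (rule Lim_transform_eventually)
    then have lim: "(\<lambda>m. \<Sum>i\<in>UNIV. (real (p m $ i) / N m) *\<^sub>R real_point (a i)) \<longlonglongrightarrow> x"
      unfolding c(3)[symmetric] by (intro tendsto_sum tendsto_scaleR tendsto_const)
    have "\<forall>\<^sub>F m in sequentially. (\<Sum>i\<in>UNIV. (real (p m $ i) / N m) *\<^sub>R real_point (a i)) \<in> ?K"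
      using eventually_gt_at_top[of 0]
    proof eventually_elim
      fix m :: nat assume m: "0 < m"
      have "real m * sum c UNIV \<le> N m" unfolding N_def sum_distrib_left by (intro sum_mono p)
      then have "N m > 0" using m c(2) by simp
      then show "(\<Sum>i\<in>UNIV. (real (p m $ i) / N m) *\<^sub>R real_point (a i)) \<in> ?K"
        unfolding N_def by (rule fan_covers_rational)
    qed
    then show "x \<in> ?K"
      using Lim_in_closed_set[OF \<open>closed ?K\<close> _ _ lim] by simp
  qed
qed

lemma fan_triangulation: "is_triangulation a \<Delta>"
  unfolding is_triangulation_def
proof (intro exI conjI)
  let ?pt = "\<lambda>i. real_point (a i)"
  let ?C = "(\<lambda>\<sigma>. convex hull (?pt ` \<sigma>)) ` \<Delta>"
  have fin: "finite \<Delta>" by (rule finite_subset[of _ UNIV]) auto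
  have ext: "x extreme_point_of convex hull (?pt ` \<sigma>) \<longleftrightarrow> x \<in> ?pt ` \<sigma>" if "\<sigma> \<in> \<Delta>" for x \<sigma>
    using extreme_point_of_convex_hull_affine_independent[OF fan_affine_independent[OF that]] .
  show "simplicial_complex ?C"
    unfolding simplicial_complex_def
  proof (intro conjI ballI allI impI; (elim conjE imageE)?)
    show "finite ?C" using fin by simp
  next
    fix S \<sigma> assume "S = convex hull (?pt ` \<sigma>)" "\<sigma> \<in> \<Delta>"
    \<comment> \<open>The dimension is an integer, since the empty simplex has dimension -1.\<close>
    then show "\<exists>n. n simplex S"
      using fan_affine_independent[of \<sigma>] by (intro exI[of _ "int (card (?pt ` \<sigma>)) - 1"]) (auto intro!: simplex_convex_hull)
  next
    fix F S \<sigma> assume S: "F face_of S" "S = convex hull (?pt ` \<sigma>)" "\<sigma> \<in> \<Delta>"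
    then obtain X where X: "X \<subseteq> ?pt ` \<sigma>" "F = convex hull X"
      using face_of_convex_hull_affine_independent[OF fan_affine_independent[OF S(3)]] by auto
    then obtain \<tau> where "\<tau> \<subseteq> \<sigma>" "X = ?pt ` \<tau>" by (auto simp: subset_image_iff)
    then show "F \<in> ?C" using X simplicial_fan_subset[OF fan S(3)] by blast
  next
    fix S S' \<sigma> \<tau> assume S: "S = convex hull (?pt ` \<sigma>)" "\<sigma> \<in> \<Delta>" "S' = convex hull (?pt ` \<tau>)" "\<tau> \<in> \<Delta>"
    then have "S \<inter> S' = convex hull (?pt ` (\<sigma> \<inter> \<tau>))" using fan_convex_hull_Int by simp
    moreover have "?pt ` (\<sigma> \<inter> \<tau>) \<subseteq> ?pt ` \<sigma>" by blast
    ultimately show "S \<inter> S' face_of S"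
      unfolding S(1) face_of_convex_hull_affine_independent[OF fan_affine_independent[OF S(2)]]
      by (intro exI conjI)
  qed
  show "\<Union>?C = convex hull (range ?pt)" using fan_covers by simp
  show "\<forall>S\<in>?C. {x. x extreme_point_of S} \<subseteq> range ?pt" using ext by auto
  have "{i. ?pt i extreme_point_of convex hull (?pt ` \<sigma>)} = \<sigma>" if "\<sigma> \<in> \<Delta>" for \<sigma>
    using ext[OF that] inj_real_point[OF inj] by (auto dest: injD)
  then show "\<Delta> = (\<lambda>S. {i. ?pt i extreme_point_of S}) ` ?C" by (simp add: image_image)
qed

end


section \<open>Standard monomials of monomial ideals\<close>

lemma mdeg_homogenized_matrix_eq_0:
  assumes "mdeg (homogenized_matrix a) r = 0"
  shows "r = 0"
proof -
  have "(\<Sum>i\<in>UNIV. real (r $ i)) = 0"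
    using mdeg_homogenized_matrix_eq(1)[of a r 0] assms by (simp add: vec_eq_iff mdeg_component)
  then show ?thesis by (simp add: sum_nonneg_eq_0_iff vec_eq_iff)
qed

section \<open>Membership in monomial ideals\<close>

lemma monom_mult: "monom u * monom w = monom (u + w)"
  by (simp add: monom_def mult_single)

lemma monom_power: "monom u ^ m = monom (m *s u)"
proof (induction m)
  case 0
  have "(0 :: nat) *s u = 0" by (simp add: vec_eq_iff)
  then show ?case by (simp add: monom_def)
next
  case (Suc m)
  have "u + m *s u = Suc m *s u" by (simp add: vec_eq_iff)
  then show ?case using Suc by (simp add: monom_mult)
qed

lemma prod_var: "(\<Prod>i\<in>\<sigma>. var i) = monom (\<chi> i. if i \<in> \<sigma> then 1 else 0)"
proof (induction \<sigma> rule: infinite_finite_induct)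
  case empty
  have "(\<chi> i. if i \<in> {} then 1 else 0) = (0 :: nat ^ 'a)" by (simp add: vec_eq_iff)
  then show ?case by (simp add: monom_def)
next
  case (insert j \<sigma>)
  have "axis j 1 + (\<chi> i. if i \<in> \<sigma> then 1 else 0) = (\<chi> i. if i \<in> insert j \<sigma> then 1 else (0::nat))"
    using insert(2) by (auto simp: vec_eq_iff axis_def)
  then show ?case using insert by (simp add: var_def monom_mult)
qed simp

text \<open>Polynomials whose terms are all divisible by generators form an ideal; conversely, such
  a polynomial is the sum of its terms.\<close>

lemma in_span_monom_iff:
  fixes f :: "('n::finite, 'k::field) mpoly"
  shows "f \<in> ideal.span (monom ` U) \<longleftrightarrow> (\<forall>w\<in>Poly_Mapping.keys f. \<exists>u\<in>U. u \<le> w)"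
proof
  let ?J = "{f :: ('n, 'k) mpoly. \<forall>w\<in>Poly_Mapping.keys f. \<exists>u\<in>U. u \<le> w}"
  have mult: "\<exists>u\<in>U. u \<le> w" if g: "\<forall>w\<in>Poly_Mapping.keys g. \<exists>u\<in>U. u \<le> w" and w: "w \<in> Poly_Mapping.keys (h * g)"
    for w and g h :: "('n, 'k) mpoly"
  proof -
    obtain x y where "w = x + y" "y \<in> Poly_Mapping.keys g" using w keys_mult[of h g] by blast
    moreover from this obtain u where "u \<in> U" "u \<le> y" using g by blast
    moreover have "y \<le> x + y" by (simp add: less_eq_vec_def)
    ultimately show ?thesis using order_trans by blast
  qed
  have "ideal.subspace ?J"
    unfolding ideal.subspace_def
  proof (intro conjI allI ballI)
    fix g h assume "g \<in> ?J" "h \<in> ?J"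
    then show "g + h \<in> ?J" using keys_add[of g h] by blast
  next
    fix g h assume "g \<in> ?J"
    then show "h * g \<in> ?J" using mult[of g _ h] by blast
  qed simp
  moreover have "monom ` U \<subseteq> ?J" by (auto simp: monom_def)
  ultimately have "ideal.span (monom ` U) \<subseteq> ?J" by (rule ideal.span_minimal[rotated])
  then show "f \<in> ideal.span (monom ` U) \<Longrightarrow> \<forall>w\<in>Poly_Mapping.keys f. \<exists>u\<in>U. u \<le> w" by blast
next
  assume f: "\<forall>w\<in>Poly_Mapping.keys f. \<exists>u\<in>U. u \<le> w"
  have "Poly_Mapping.single w (Poly_Mapping.lookup f w) \<in> ideal.span (monom ` U)"
    if "w \<in> Poly_Mapping.keys f" for w
  proof -
    obtain u where u: "u \<in> U" "u \<le> w" using f \<open>w \<in> Poly_Mapping.keys f\<close> by blast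
    then have "w = (w - u) + u" by (simp add: vec_eq_iff less_eq_vec_def)
    then have "Poly_Mapping.single w (Poly_Mapping.lookup f w) = Poly_Mapping.single (w - u) (Poly_Mapping.lookup f w) * monom u"
      by (metis monom_def mult_single mult.right_neutral)
    then show ?thesis using u(1) by (simp add: ideal.span_scale ideal.span_base)
  qed
  then have "(\<Sum>w\<in>Poly_Mapping.keys f. Poly_Mapping.single w (Poly_Mapping.lookup f w)) \<in> ideal.span (monom ` U)"
    by (rule ideal.span_sum)
  moreover have "f = (\<Sum>w\<in>Poly_Mapping.keys f. Poly_Mapping.single w (Poly_Mapping.lookup f w))"
    by (rule poly_mapping_eqI) (simp add: lookup_sum lookup_single when_def in_keys_iff)
  ultimately show "f \<in> ideal.span (monom ` U)" by metis
qed

lemma monom_in_span_iff: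
  "(monom w :: ('n::finite, 'k::field) mpoly) \<in> ideal.span (monom ` U) \<longleftrightarrow> (\<exists>u\<in>U. u \<le> w)"
  unfolding in_span_monom_iff by (simp add: monom_def)

lemma in_monomial_ideal_iff:
  fixes I :: "('n::finite, 'k::field) mpoly set"
  assumes "monomial_ideal I"
  shows "f \<in> I \<longleftrightarrow> (\<forall>w\<in>Poly_Mapping.keys f. monom w \<in> I)"
  using assms unfolding monomial_ideal_def
  by (auto simp: monom_in_span_iff) (simp_all add: in_span_monom_iff)

lemma monom_in_monomial_ideal_mono:
  fixes I :: "('n::finite, 'k::field) mpoly set"
  assumes "monomial_ideal I" "monom w \<in> I" "w \<le> w'"
  shows "monom w' \<in> I"
  using assms unfolding monomial_ideal_def by (auto simp: monom_in_span_iff) (blast intro: order_trans)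

text \<open>The basis element \<open>f\<close> of a one-dimensional quotient piece has a term
  outside \<open>I\<close>, which gives existence in the fiber. Two standard monomials of one degree
  would be dependent modulo \<open>I\<close>.\<close>

lemma standard_section_standard_monomials:
  fixes A :: "int ^ 'n::finite ^ 'm::finite" and I :: "('n, 'k::field) mpoly set"
  assumes "monomial_A_graded A I"
  shows "standard_section A {w. (monom w :: ('n, 'k) mpoly) \<notin> I}"
  unfolding standard_section_def
proof (intro conjI ballI allI impI)
  have mono: "monomial_ideal I" using assms by (simp add: monomial_A_graded_def)
  fix w w' :: "nat ^ 'n"
  assume "w \<in> {w. (monom w :: ('n, 'k) mpoly) \<notin> I}" "w' \<le> w"
  then show "w' \<in> {w. (monom w :: ('n, 'k) mpoly) \<notin> I}"
    using monom_in_monomial_ideal_mono[OF mono] by blast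
next
  fix u :: "nat ^ 'n"
  have mono: "monomial_ideal I" using assms by (simp add: monomial_A_graded_def)
  then obtain U where U: "I = ideal.span (monom ` U)" unfolding monomial_ideal_def by blast
  let ?b = "mdeg A u"
  have "quotient_dim (graded_piece A ?b) I 1"
    using assms by (auto simp: monomial_A_graded_def A_graded_def split: if_splits)
  then obtain B where B: "card B = 1" "B \<subseteq> graded_piece A ?b"
    and indep: "\<forall>c. (\<Sum>f\<in>B. const (c f) * f) \<in> I \<longrightarrow> (\<forall>f\<in>B. c f = 0)"
    and gen: "\<forall>g\<in>graded_piece A ?b. \<exists>c. g - (\<Sum>f\<in>B. const (c f) * f) \<in> I"
    unfolding quotient_dim_def by (elim exE conjE)
  obtain f where f: "B = {f}" using B(1) by (auto simp: card_1_singleton_iff)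
  have "f \<notin> I" using indep[rule_format, of "\<lambda>_. 1"] by (auto simp: f const_def)
  then obtain w where w: "w \<in> Poly_Mapping.keys f" "(monom w :: ('n, 'k) mpoly) \<notin> I"
    using in_monomial_ideal_iff[OF mono] by blast
  have "mdeg A w = ?b" using B(2) w(1) by (auto simp: f graded_piece_def)
  moreover have "w1 = w2" if "(monom w1 :: ('n, 'k) mpoly) \<notin> I" "mdeg A w1 = ?b"
      "(monom w2 :: ('n, 'k) mpoly) \<notin> I" "mdeg A w2 = ?b" for w1 w2
  proof (rule ccontr)
    assume "w1 \<noteq> w2"
    have "\<exists>c. monom x - const c * f \<in> I" if "mdeg A x = ?b" for x
      using gen[rule_format, of "monom x"] that by (auto simp: graded_piece_def monom_def f)
    from this[OF that(2)] this[OF that(4)] obtain c1 c2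
      where c: "monom w1 - const c1 * f \<in> I" "monom w2 - const c2 * f \<in> I" by blast
    have "c1 \<noteq> 0" using c(1) that(1) by (auto simp: const_def)
    \<comment> \<open>Eliminating \<open>f\<close> leaves a binomial in \<open>I\<close> whose
      coefficient at \<open>w2\<close> is \<open>- c1\<close>, which is nonzero because
      \<open>w1\<close> is standard. A monomial ideal then contains \<open>monom w2\<close>.\<close>
    have "const c2 * (monom w1 - const c1 * f) - const c1 * (monom w2 - const c2 * f) \<in> I"
      unfolding U by (intro ideal.span_diff ideal.span_scale c[unfolded U])
    also have "const c2 * (monom w1 - const c1 * f) - const c1 * (monom w2 - const c2 * f)
        = const c2 * monom w1 - const c1 * monom w2"
      by (simp only: right_diff_distrib mult.left_commute[of "const c1" "const c2" f]
          diff_diff_eq2 diff_add_cancel)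
    finally have "\<forall>w\<in>Poly_Mapping.keys (const c2 * monom w1 - const c1 * monom w2). monom w \<in> I"
      using in_monomial_ideal_iff[OF mono] by (rule iffD1[rotated])
    moreover have "Poly_Mapping.lookup (const c2 * monom w1 - const c1 * monom w2) w2 = - c1"
      using \<open>w1 \<noteq> w2\<close> by (simp add: const_def monom_def mult_single lookup_minus lookup_single)
    then have "w2 \<in> Poly_Mapping.keys (const c2 * monom w1 - const c1 * monom w2)"
      using \<open>c1 \<noteq> 0\<close> by (simp add: in_keys_iff)
    ultimately show False using that(3) by (rule bspec[THEN notE[rotated]])
  qed
  ultimately show "\<exists>!w. w \<in> {w. (monom w :: ('n, 'k) mpoly) \<notin> I} \<and> mdeg A w = ?b"
    using w(2) by blast
qed

lemma stanley_reisner_rad: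
  fixes I :: "('n::finite, 'k::field) mpoly set"
  assumes "monomial_ideal I"
  shows "stanley_reisner (rad I) = face_complex {w. (monom w :: ('n, 'k) mpoly) \<notin> I}"
proof -
  let ?e = "\<lambda>\<sigma>. \<chi> i. if i \<in> \<sigma> then 1 else (0 :: nat)"
  have "(\<forall>m. (monom (m *s ?e \<sigma>) :: ('n, 'k) mpoly) \<notin> I) \<longleftrightarrow>
      (\<forall>w. msupp w \<subseteq> \<sigma> \<longrightarrow> (monom w :: ('n, 'k) mpoly) \<notin> I)" for \<sigma>
  proof (intro iffI allI impI)
    fix w assume I: "\<forall>m. (monom (m *s ?e \<sigma>) :: ('n, 'k) mpoly) \<notin> I" and w: "msupp w \<subseteq> \<sigma>"
    \<comment> \<open>The total degree bounds every coordinate, so powers of the squarefree monomial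
      of \<open>\<sigma>\<close> are cofinal among the monomials supported on
      \<open>\<sigma>\<close>.\<close>
    have "w \<le> (\<Sum>i\<in>UNIV. w $ i) *s ?e \<sigma>"
      using w by (auto simp: less_eq_vec_def msupp_def intro: member_le_sum)
    then show "(monom w :: ('n, 'k) mpoly) \<notin> I"
      using monom_in_monomial_ideal_mono[OF assms] I by blast
  next
    fix m assume "\<forall>w. msupp w \<subseteq> \<sigma> \<longrightarrow> (monom w :: ('n, 'k) mpoly) \<notin> I"
    moreover have "msupp (m *s ?e \<sigma>) \<subseteq> \<sigma>" by (auto simp: msupp_def split: if_splits)
    ultimately show "(monom (m *s ?e \<sigma>) :: ('n, 'k) mpoly) \<notin> I" by blast
  qed
  then show ?thesis
    by (auto simp: stanley_reisner_def rad_def face_complex_def prod_var monom_power)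
qed

lemma ex_minimal_generator_le:
  assumes "monom w \<in> I"
  obtains c where "minimal_generator I c" "c \<le> w"
proof -
  obtain c where c: "monom c \<in> I" "c \<le> w"
    and least: "\<And>y. monom y \<in> I \<Longrightarrow> y \<le> w \<Longrightarrow> (\<Sum>i\<in>UNIV. c $ i) \<le> (\<Sum>i\<in>UNIV. y $ i)"
    using ex_has_least_nat[of "\<lambda>c. monom c \<in> I \<and> c \<le> w" w "\<lambda>c. \<Sum>i\<in>UNIV. c $ i"] assms by auto
  have "monom y \<notin> I" if "y < c" for y
  proof
    assume "monom y \<in> I"
    moreover have "(\<Sum>i\<in>UNIV. y $ i) < (\<Sum>i\<in>UNIV. c $ i)"
      using that by (intro sum_strict_mono_ex1) (auto simp: less_vec_def less_eq_vec_def not_le)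
    ultimately show False using least[of y] that c(2) by (simp add: leD order_trans[of y c w])
  qed
  then show ?thesis using c by (intro that[of c]) (simp_all add: minimal_generator_def)
qed

text \<open>In a forbidden decomposition \<open>u' < c\<close>, \<open>v' < d\<close> both parts are
  standard, hence equal. The complements \<open>c - u'\<close> and \<open>d - v'\<close> are
  standard as well, hence equal, which forces \<open>c = d\<close>.\<close>

lemma graver_minimal_generator:
  fixes I :: "('n::finite, 'k::field) mpoly set"
  assumes sec: "standard_section A {w. (monom w :: ('n, 'k) mpoly) \<notin> I}"
    and c: "minimal_generator I c" and d: "(monom d :: ('n, 'k) mpoly) \<notin> I" "mdeg A d = mdeg A c"
  shows "graver A c d"
proof -
  have below: "(monom w :: ('n, 'k) mpoly) \<notin> I" if "w < c \<or> w \<le> d" for w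
    using that c sec d(1) unfolding minimal_generator_def standard_section_def by blast
  have unique: "w = w'" if "(monom w :: ('n, 'k) mpoly) \<notin> I" "(monom w' :: ('n, 'k) mpoly) \<notin> I"
    "mdeg A w = mdeg A w'" for w w'
    using sec that unfolding standard_section_def by blast
  have "c \<noteq> d" using c d(1) by (auto simp: minimal_generator_def)
  moreover have False if uv: "u' \<noteq> 0" "v' \<noteq> 0" "mdeg A u' = mdeg A v'" "u' < c" "v' < d" for u' v'
  proof -
    have "u' = v'" using unique[OF below below uv(3)] uv(4,5) by (simp add: less_imp_le)
    have c': "c = u' + (c - u')" and d': "d = v' + (d - v')"
      using uv(4,5) by (simp_all add: less_vec_def less_eq_vec_def vec_eq_iff)
    have "c - u' \<le> c" "d - v' \<le> d" by (simp_all add: less_eq_vec_def)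
    moreover have "c - u' \<noteq> c" using c' uv(1) by (metis add_cancel_left_left)
    ultimately have "c - u' < c" "d - v' \<le> d" by simp_all
    moreover have "mdeg A (c - u') = mdeg A (d - v')"
      using d(2) mdeg_add[of A u' "c - u'"] mdeg_add[of A v' "d - v'"] uv(3)
      by (simp flip: c' d')
    ultimately have "c - u' = d - v'" using unique[OF below below] by blast
    then show False using c' d' \<open>u' = v'\<close> \<open>c \<noteq> d\<close> by metis
  qed
  ultimately show ?thesis using d(2) unfolding graver_def by metis
qed

text \<open>A common variable \<open>e\<close> gives the forbidden pair of \<open>e\<close> with
  itself. It is strictly below both sides: by positivity of the grading, equality with one side
  would force equality with the other.\<close>

lemma graver_disjoint:
  assumes "graver (homogenized_matrix a) u v"
  shows "msupp u \<inter> msupp v = {}"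
proof (rule ccontr)
  assume "msupp u \<inter> msupp v \<noteq> {}"
  then obtain i where i: "u $ i \<noteq> 0" "v $ i \<noteq> 0" by (auto simp: msupp_def)
  define e :: "nat ^ 'a" where "e = axis i 1"
  have e: "e \<le> u" "e \<le> v" "e \<noteq> 0"
    using i by (auto simp: e_def less_eq_vec_def axis_def vec_eq_iff)
  have deg: "mdeg (homogenized_matrix a) u = mdeg (homogenized_matrix a) v" and "u \<noteq> v"
    using assms by (auto simp: graver_def)
  have eq: "y = e" if y: "e \<le> y" "mdeg (homogenized_matrix a) y = mdeg (homogenized_matrix a) e" for y
  proof -
    have y': "y = e + (y - e)" using y(1) by (simp add: less_eq_vec_def vec_eq_iff)
    then have "mdeg (homogenized_matrix a) (y - e) = 0"
      using mdeg_add[of "homogenized_matrix a" e "y - e"] y(2) by (metis add_cancel_left_right)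
    then show ?thesis using y' mdeg_homogenized_matrix_eq_0 by (metis add.right_neutral)
  qed
  have "e < u" using e(1) eq[OF e(2)] deg \<open>u \<noteq> v\<close> by (metis order_le_less)
  moreover have "e < v" using e(2) eq[OF e(1)] deg \<open>u \<noteq> v\<close> by (metis order_le_less)
  ultimately show False using assms e(3) unfolding graver_def by blast
qed

section \<open>Comparison of the complexes of an ideal and its flip\<close>

theorem theorem5p2:
  fixes a :: "'n::finite \<Rightarrow> int ^ 'd::finite"
    and I :: "('n, 'k::field) mpoly set"
    and u v :: "nat ^ 'n"
  assumes "inj a"
    and "full_row_rank (homogenized_matrix a)"
    and "monomial_A_graded (homogenized_matrix a) I"
    and "flippable (homogenized_matrix a) I u v"
  shows "stanley_reisner (rad I) = stanley_reisner (rad (ideal_flip (homogenized_matrix a) I u v)) \<or>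
         differ_by_bistellar_flip a (stanley_reisner (rad I))
           (stanley_reisner (rad (ideal_flip (homogenized_matrix a) I u v)))"
proof -
  let ?A = "homogenized_matrix a"
  define J where "J = ideal_flip ?A I u v"
  define M M' where "M = {w. (monom w :: ('n, 'k) mpoly) \<notin> I}"
    and "M' = {w. (monom w :: ('n, 'k) mpoly) \<notin> J}"
  have uv: "graver ?A u v" "minimal_generator I u" and J: "monomial_A_graded ?A J"
    using assms(4) by (simp_all add: flippable_def J_def)
  have mono: "monomial_ideal I" "monomial_ideal J"
    using assms(3) J by (simp_all add: monomial_A_graded_def)
  have sec: "standard_section ?A M" "standard_section ?A M'"
    unfolding M_def M'_def using standard_section_standard_monomials assms(3) J by blast+
  define G where "G = {c. \<exists>d. graver ?A c d \<and> (monom c :: ('n, 'k) mpoly) \<in> I \<and>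
      (monom d :: ('n, 'k) mpoly) \<notin> I \<and> c \<noteq> u}"
  have "J = ideal.span (monom ` (G \<union> {v}))"
    unfolding J_def ideal_flip_def G_def by (rule arg_cong[where f = ideal.span]) blast
  then have in_J: "(monom w :: ('n, 'k) mpoly) \<in> J \<longleftrightarrow> (\<exists>c\<in>G. c \<le> w) \<or> v \<le> w" for w
    by (simp only: monom_in_span_iff bex_Un) simp
  \<comment> \<open>All generators of \<open>J\<close> other than \<open>v\<close> lie in
    \<open>I\<close>.\<close>
  have v_le: "v \<le> w" if "w \<in> M" "w \<notin> M'" for w
    using that in_J[of w] monom_in_monomial_ideal_mono[OF mono(1), of _ w]
    by (auto simp: M_def M'_def G_def)
  \<comment> \<open>A minimal generator \<open>c\<close> of \<open>I\<close> below \<open>w\<close>,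
    paired with the standard \<open>d\<close> of its fiber, is Graver. It would generate an element
    of \<open>J\<close> below \<open>w\<close> unless \<open>c = u\<close>.\<close>
  have u_le: "u \<le> w" if w: "w \<in> M'" "w \<notin> M" for w
  proof -
    obtain c where c: "minimal_generator I c" "c \<le> w"
      using ex_minimal_generator_le[of w I] w(2) by (auto simp: M_def)
    obtain d where d: "d \<in> M" "mdeg ?A d = mdeg ?A c"
      using sec(1) unfolding standard_section_def by metis
    have "graver ?A c d"
      using graver_minimal_generator[OF sec(1)[unfolded M_def] c(1) _ d(2)] d(1) by (simp add: M_def)
    then have "c = u"
      using w(1) in_J[of w] c d(1) unfolding M_def M'_def G_def minimal_generator_def by blast
    then show ?thesis using c(2) by simp
  qed
  have supp_mono: "msupp x \<subseteq> msupp y" if "x \<le> y" for x y :: "nat ^ 'n"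
    using that by (auto simp: msupp_def less_eq_vec_def intro: less_le_trans)
  let ?\<Delta> = "face_complex M" and ?\<Delta>' = "face_complex M'"
  have SR: "stanley_reisner (rad I) = ?\<Delta>" "stanley_reisner (rad J) = ?\<Delta>'"
    unfolding M_def M'_def using mono by (simp_all add: stanley_reisner_rad)
  have fan: "simplicial_fan ?A ?\<Delta>" "simplicial_fan ?A ?\<Delta>'"
    using sec by (simp_all add: simplicial_fan_face_complex)
  have u: "msupp u \<notin> ?\<Delta>" using uv(2) by (auto simp: face_complex_def M_def minimal_generator_def)
  have v: "msupp v \<notin> ?\<Delta>'" using in_J[of v] by (auto simp: face_complex_def M'_def)
  \<comment> \<open>A simplex lost by the flip supports some \<open>w\<close> that is standard for
    \<open>I\<close> but not for \<open>J\<close>; then \<open>v \<le> w\<close> puts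
    \<open>msupp v\<close> inside it.\<close>
  have common: "\<sigma> \<in> ?\<Delta>'" if "\<sigma> \<in> ?\<Delta>" "\<not> msupp v \<subseteq> \<sigma>" for \<sigma>
    using that v_le supp_mono unfolding face_complex_def by blast
  have common': "\<sigma> \<in> ?\<Delta>" if "\<sigma> \<in> ?\<Delta>'" "\<not> msupp u \<subseteq> \<sigma>" for \<sigma>
    using that u_le supp_mono unfolding face_complex_def by blast
  have deg: "mdeg ?A u = mdeg ?A v" using uv(1) by (simp add: graver_def)
  show ?thesis
  proof (cases "?\<Delta> = ?\<Delta>'")
    case True
    then show ?thesis using SR unfolding J_def by simp
  next
    case False
    obtain t where "circuit ?A t" "flips_to (circuit_plus t) (circuit_minus t) ?\<Delta> ?\<Delta>'"
      using flip_of_exchanges[OF fan deg graver_disjoint[OF uv(1)] u v common common' False] by blast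
    then have "bistellar_flip a ?\<Delta> ?\<Delta>'" unfolding bistellar_flip_def by blast
    then have "differ_by_bistellar_flip a ?\<Delta> ?\<Delta>'"
      using fan_triangulation[OF assms(1)] fan by (simp add: differ_by_bistellar_flip_def)
    then show ?thesis using SR unfolding J_def by simp
  qed
qed

end
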